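(* The decision problem of energy games on complete bipartite game graphs is polynomial-time equivalent to the decision problem of energy games on general game graphs.
   Context: A weighted game graph $(G,w)$ consists of a finite directed graph $G=(V,E)$ in which every node has out-degree at least $1$, a partition $V=V_A\cup V_B$ into nodes of Alice and of Bob, and integer edge weights $w:E\to\mathbb{Z}$. A (positional) strategy $\sigma$ of Alice picks for each $u\in V_A$ an out-neighbor $\sigma(u)$; a strategy $\tau$ of Bob picks for each $u\in V_B$ an out-neighbor $\tau(u)$. $G(\sigma,\tau)$ is the subgraph with edges $\{(u,\sigma(u)):u\in V_A\}\cup\{(u,\tau(u)):u\in V_B\}$; from any node $s$ there is a unique cycle $C$ reachable in it. $w(P)$ is total weight. Set $e^*_{G(\sigma,\tau),w}(s)=\infty$ if $w(C)<0$, else $\max\{0,-\min_P w(P)\}$ over simple paths $P$ in $G(\sigma,\tau)$ starting at $s$. The minimal energy is $e^*_{G,w}(s)=\min_\sigma\max_\tau e^*_{G(\sigma,\tau),w}(s)$. The decision problem: given $(G,w)$ and a node $s$, decide whether $e^*_{G,w}(s)<\infty$ (Alice wins at $s$). The graph is complete bipartite if there is no edge between two nodes of $V_A$ nor between two nodes of $V_B$, and for every $u\in V_A$, $v\in V_B$ both $(u,v)$ and $(v,u)$ are edges. *)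

theory Defs
  imports
    "HOL-Library.Extended_Nat"
    "HOL-Library.FuncSet"
    "HOL-Computational_Algebra.Polynomial"
    "Graph_Theory.Pair_Digraph"
begin

section \<open>Energy games\<close>

record 'v weighted_game =
  arena :: "'v pair_pre_digraph"
  alice :: "'v set"
  bob :: "'v set"
  weight :: "'v \<times> 'v \<Rightarrow> int"

definition weighted_game_graph :: "'v weighted_game \<Rightarrow> bool" where
  "weighted_game_graph \<Gamma> \<longleftrightarrow>
     pair_fin_digraph (arena \<Gamma>) \<and>
     alice \<Gamma> \<union> bob \<Gamma> = pverts (arena \<Gamma>) \<and> alice \<Gamma> \<inter> bob \<Gamma> = {} \<and>
     (\<forall>u \<in> pverts (arena \<Gamma>). \<exists>v. (u, v) \<in> parcs (arena \<Gamma>))"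

definition complete_bipartite_game :: "'v weighted_game \<Rightarrow> bool" where
  "complete_bipartite_game \<Gamma> \<longleftrightarrow>
     parcs (arena \<Gamma>) \<inter> (alice \<Gamma> \<times> alice \<Gamma>) = {} \<and>
     parcs (arena \<Gamma>) \<inter> (bob \<Gamma> \<times> bob \<Gamma>) = {} \<and>
     (\<forall>u \<in> alice \<Gamma>. \<forall>v \<in> bob \<Gamma>. (u, v) \<in> parcs (arena \<Gamma>) \<and> (v, u) \<in> parcs (arena \<Gamma>))"

text \<open>
  Strategies are extensional functions, so that a player has only finitely many of them
  and minima and maxima over strategies are attained.
\<close>

definition strategies :: "'v weighted_game \<Rightarrow> 'v set \<Rightarrow> ('v \<Rightarrow> 'v) set" where
  "strategies \<Gamma> U = (\<Pi>\<^sub>E u\<in>U. {v. (u, v) \<in> parcs (arena \<Gamma>)})"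

definition strategy_graph ::
    "'v weighted_game \<Rightarrow> ('v \<Rightarrow> 'v) \<Rightarrow> ('v \<Rightarrow> 'v) \<Rightarrow> 'v pair_pre_digraph" where
  "strategy_graph \<Gamma> \<sigma> \<tau> =
     \<lparr> pverts = pverts (arena \<Gamma>),
       parcs = {(u, \<sigma> u) | u. u \<in> alice \<Gamma>} \<union> {(u, \<tau> u) | u. u \<in> bob \<Gamma>} \<rparr>"

definition path_weight :: "'v weighted_game \<Rightarrow> ('v \<times> 'v) list \<Rightarrow> int" where
  "path_weight \<Gamma> p = (\<Sum>e\<leftarrow>p. weight \<Gamma> e)"

text \<open>
  In a strategy graph the cycle reachable from \<open>s\<close> is unique only up to the choice of its first
  arc, which does not affect its weight. Cycles may be loops, and the empty path is a simple path.
\<close>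

definition play_energy ::
    "'v weighted_game \<Rightarrow> ('v \<Rightarrow> 'v) \<Rightarrow> ('v \<Rightarrow> 'v) \<Rightarrow> 'v \<Rightarrow> enat" where
  "play_energy \<Gamma> \<sigma> \<tau> s =
     (let H = with_proj (strategy_graph \<Gamma> \<sigma> \<tau>) in
      if \<exists>C. pre_digraph.cycle H C \<and> s \<rightarrow>\<^sup>*\<^bsub>H\<^esub> fst (hd C) \<and> path_weight \<Gamma> C < 0
      then \<infinity>
      else enat (nat (max 0 (- Min {path_weight \<Gamma> P | P v. pre_digraph.apath H s P v}))))"

definition minimal_energy :: "'v weighted_game \<Rightarrow> 'v \<Rightarrow> enat" where
  "minimal_energy \<Gamma> s =
     (MIN \<sigma>\<in>strategies \<Gamma> (alice \<Gamma>). MAX \<tau>\<in>strategies \<Gamma> (bob \<Gamma>). play_energy \<Gamma> \<sigma> \<tau> s)"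


section \<open>Polynomial-time computable functions\<close>

text \<open>
  Deterministic Turing machines with any fixed number of two-way infinite tapes over the symbols
  0, 1 and blank (\<open>None\<close>). Position 0 of a tape is the cell under the head; a head movement shifts
  the tape. The states are the numbers below \<open>state_count\<close>, the start state is 0, and the
  machine has halted once its state is not below \<open>state_count\<close>; hence only the finite part of
  \<open>transition\<close> that concerns those states and the \<open>tape_count\<close> scanned symbols matters.
\<close>

type_synonym symbol = "bool option"
type_synonym tape = "int \<Rightarrow> symbol"

datatype move = Move_Left | No_Move | Move_Right

primrec offset :: "move \<Rightarrow> int" where
  "offset Move_Left = -1"
| "offset No_Move = 0"
| "offset Move_Right = 1"

record turing_machine =
  tape_count :: nat
  state_count :: nat
  transition :: "nat \<Rightarrow> symbol list \<Rightarrow> nat \<times> (symbol \<times> move) list"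

definition turing_machine :: "turing_machine \<Rightarrow> bool" where
  "turing_machine M \<longleftrightarrow> 0 < tape_count M \<and>
     (\<forall>q < state_count M. \<forall>ss. length ss = tape_count M \<longrightarrow>
        length (snd (transition M q ss)) = tape_count M)"

definition act :: "symbol \<times> move \<Rightarrow> tape \<Rightarrow> tape" where
  "act a t = (\<lambda>i. (t(0 := fst a)) (i + offset (snd a)))"

definition step :: "turing_machine \<Rightarrow> nat \<times> tape list \<Rightarrow> nat \<times> tape list" where
  "step M = (\<lambda>(q, ts).
     if q < state_count M
     then let (q', as) = transition M q (map (\<lambda>t. t 0) ts) in (q', map2 act as ts)
     else (q, ts))"

definition word_tape :: "bool list \<Rightarrow> tape" where
  "word_tape x = (\<lambda>i. if 0 \<le> i \<and> i < int (length x) then Some (x ! nat i) else None)"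

definition start_config :: "turing_machine \<Rightarrow> bool list \<Rightarrow> nat \<times> tape list" where
  "start_config M x = (0, word_tape x # replicate (tape_count M - 1) (word_tape []))"

text \<open>Input and output are both on the first tape.\<close>

definition halts_with :: "turing_machine \<Rightarrow> bool list \<Rightarrow> nat \<Rightarrow> bool list \<Rightarrow> bool" where
  "halts_with M x t y \<longleftrightarrow>
     (let (q, ts) = (step M ^^ t) (start_config M x)
      in state_count M \<le> q \<and> ts ! 0 = word_tape y)"

definition polytime_computable :: "(bool list \<Rightarrow> bool list) \<Rightarrow> bool" where
  "polytime_computable f \<longleftrightarrow>
     (\<exists>M (p :: nat poly). turing_machine M \<and>
        (\<forall>x. \<exists>t \<le> poly p (length x). halts_with M x t (f x)))"


section \<open>Decision problems and reductions\<close>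

text \<open>
  A decision problem consists of the set of its (encoded) instances and the subset of its
  yes-instances. Polynomial-time equivalence means many-one reducibility in both directions.
\<close>

record decision_problem =
  instances :: "bool list set"
  yes_instances :: "bool list set"

definition polytime_reducible :: "decision_problem \<Rightarrow> decision_problem \<Rightarrow> bool" where
  "polytime_reducible P Q \<longleftrightarrow>
     (\<exists>f. polytime_computable f \<and>
        (\<forall>x \<in> instances P. f x \<in> instances Q \<and>
           (x \<in> yes_instances P \<longleftrightarrow> f x \<in> yes_instances Q)))"

definition polytime_equivalent :: "decision_problem \<Rightarrow> decision_problem \<Rightarrow> bool" where
  "polytime_equivalent P Q \<longleftrightarrow> polytime_reducible P Q \<and> polytime_reducible Q P"


section \<open>Encoding of energy games\<close>

text \<open>
  The nodes of an encoded game are \<open>0, \<dots>, n - 1\<close>. The encoding lists \<open>n\<close> and the given node in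
  unary (the encoding has length at least \<open>n\<^sup>2\<close> anyway), followed, for every node, by its owner and
  its row of the weighted adjacency matrix. Weights are written in binary: sign, then
  the bits of the absolute value, least significant bit first, each preceded by a continuation
  bit.
\<close>

fun encode_nat :: "nat \<Rightarrow> bool list" where
  "encode_nat m = (if m = 0 then [False] else True # odd m # encode_nat (m div 2))"

declare encode_nat.simps [simp del]

definition encode_int :: "int \<Rightarrow> bool list" where
  "encode_int k = (k < 0) # encode_nat (nat \<bar>k\<bar>)"

definition encode_unary :: "nat \<Rightarrow> bool list" where
  "encode_unary n = replicate n True @ [False]"

definition encode_entry :: "nat weighted_game \<Rightarrow> nat \<times> nat \<Rightarrow> bool list" where
  "encode_entry \<Gamma> e =
     (if e \<in> parcs (arena \<Gamma>) then True # encode_int (weight \<Gamma> e) else [False])"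

definition encode_row :: "nat weighted_game \<Rightarrow> nat \<Rightarrow> nat \<Rightarrow> bool list" where
  "encode_row \<Gamma> n u = (u \<in> alice \<Gamma>) # concat (map (\<lambda>v. encode_entry \<Gamma> (u, v)) [0..<n])"

definition encode :: "nat weighted_game \<times> nat \<Rightarrow> bool list" where
  "encode = (\<lambda>(\<Gamma>, s). let n = card (pverts (arena \<Gamma>)) in
     encode_unary n @ encode_unary s @ concat (map (encode_row \<Gamma> n) [0..<n]))"

definition energy_instance :: "nat weighted_game \<times> nat \<Rightarrow> bool" where
  "energy_instance = (\<lambda>(\<Gamma>, s). weighted_game_graph \<Gamma> \<and>
     (\<exists>n. pverts (arena \<Gamma>) = {..<n}) \<and> s \<in> pverts (arena \<Gamma>))"

text \<open>The encoding determines the instance, up to the irrelevant weights of non-arcs.\<close>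

lemma encode_nat_append_cancel:
  "encode_nat m @ xs = encode_nat m' @ ys \<Longrightarrow> m = m' \<and> xs = ys"
proof (induction m arbitrary: m' rule: encode_nat.induct)
  case (1 m)
  show ?case
  proof (cases "m = 0 \<or> m' = 0")
    case True
    then show ?thesis
      using "1.prems" by (auto simp: encode_nat.simps[of m] encode_nat.simps[of m'] split: if_splits)
  next
    case False
    then have "odd m = odd m'" "encode_nat (m div 2) @ xs = encode_nat (m' div 2) @ ys"
      using "1.prems" by (auto simp: encode_nat.simps[of m] encode_nat.simps[of m'])
    with False "1.IH" have "odd m = odd m'" "m div 2 = m' div 2" "xs = ys"
      by blast+
    then show ?thesis
      by (metis div_mult_mod_eq parity_cases)
  qed
qed

lemma encode_int_append_cancel:
  assumes "encode_int k @ xs = encode_int k' @ ys"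
  shows "k = k' \<and> xs = ys"
  using assms encode_nat_append_cancel[of "nat \<bar>k\<bar>" xs "nat \<bar>k'\<bar>" ys]
  by (auto simp: encode_int_def)

lemma encode_unary_append_cancel:
  "encode_unary n @ xs = encode_unary n' @ ys \<Longrightarrow> n = n' \<and> xs = ys"
proof (induction n arbitrary: n')
  case 0
  then show ?case by (cases n') (auto simp: encode_unary_def)
next
  case (Suc n)
  then show ?case by (cases n') (auto simp: encode_unary_def)
qed

lemma concat_map_append_cancel:
  assumes "\<And>v xs ys. v \<in> set vs \<Longrightarrow> f v @ xs = g v @ ys \<Longrightarrow> P v \<and> xs = ys"
    and "concat (map f vs) @ xs = concat (map g vs) @ ys"
  shows "(\<forall>v \<in> set vs. P v) \<and> xs = ys"
  using assms
proof (induction vs)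
  case Nil
  then show ?case by simp
next
  case (Cons v vs)
  from Cons.prems(2) have "f v @ (concat (map f vs) @ xs) = g v @ (concat (map g vs) @ ys)"
    by simp
  then have "P v" and "concat (map f vs) @ xs = concat (map g vs) @ ys"
    using Cons.prems(1)[of v] by auto
  moreover from this(2) have "(\<forall>v \<in> set vs. P v) \<and> xs = ys"
    by (intro Cons.IH Cons.prems(1)) auto
  ultimately show ?case by simp
qed

definition same_entry :: "nat weighted_game \<Rightarrow> nat weighted_game \<Rightarrow> nat \<times> nat \<Rightarrow> bool" where
  "same_entry \<Gamma> \<Gamma>' e \<longleftrightarrow> (e \<in> parcs (arena \<Gamma>) \<longleftrightarrow> e \<in> parcs (arena \<Gamma>')) \<and>
     (e \<in> parcs (arena \<Gamma>) \<longrightarrow> weight \<Gamma> e = weight \<Gamma>' e)"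

lemma encode_entry_append_cancel:
  assumes "encode_entry \<Gamma> e @ xs = encode_entry \<Gamma>' e @ ys"
  shows "same_entry \<Gamma> \<Gamma>' e \<and> xs = ys"
  using assms encode_int_append_cancel[of "weight \<Gamma> e" xs "weight \<Gamma>' e" ys]
  by (auto simp: encode_entry_def same_entry_def split: if_splits)

lemma encode_row_append_cancel:
  assumes "encode_row \<Gamma> n u @ xs = encode_row \<Gamma>' n u @ ys"
  shows "((u \<in> alice \<Gamma> \<longleftrightarrow> u \<in> alice \<Gamma>') \<and> (\<forall>v \<in> set [0..<n]. same_entry \<Gamma> \<Gamma>' (u, v))) \<and> xs = ys"
proof -
  from assms have "u \<in> alice \<Gamma> \<longleftrightarrow> u \<in> alice \<Gamma>'"
    and *: "concat (map (\<lambda>v. encode_entry \<Gamma> (u, v)) [0..<n]) @ xs =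
      concat (map (\<lambda>v. encode_entry \<Gamma>' (u, v)) [0..<n]) @ ys"
    by (auto simp: encode_row_def)
  moreover have "(\<forall>v \<in> set [0..<n]. same_entry \<Gamma> \<Gamma>' (u, v)) \<and> xs = ys"
    by (rule concat_map_append_cancel[OF _ *]) (rule encode_entry_append_cancel)
  ultimately show ?thesis by blast
qed

lemma encode_injective:
  assumes inst: "energy_instance (\<Gamma>, s)" "energy_instance (\<Gamma>', s')"
    and eq: "encode (\<Gamma>, s) = encode (\<Gamma>', s')"
  shows "arena \<Gamma> = arena \<Gamma>'" "alice \<Gamma> = alice \<Gamma>'" "bob \<Gamma> = bob \<Gamma>'" "s = s'"
    and "\<And>e. e \<in> parcs (arena \<Gamma>) \<Longrightarrow> weight \<Gamma> e = weight \<Gamma>' e"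
proof -
  from inst obtain n n' where n: "pverts (arena \<Gamma>) = {..<n}" "pverts (arena \<Gamma>') = {..<n'}"
    by (auto simp: energy_instance_def)
  from eq have "encode_unary n @ encode_unary s @ concat (map (encode_row \<Gamma> n) [0..<n]) =
      encode_unary n' @ encode_unary s' @ concat (map (encode_row \<Gamma>' n') [0..<n'])"
    by (simp add: encode_def n)
  then have nn: "n = n'" and s: "s = s'"
    and rows: "concat (map (encode_row \<Gamma> n) [0..<n]) @ [] = concat (map (encode_row \<Gamma>' n) [0..<n]) @ []"
    using encode_unary_append_cancel by (metis append_Nil2)+
  have "(\<forall>u \<in> set [0..<n]. (u \<in> alice \<Gamma> \<longleftrightarrow> u \<in> alice \<Gamma>') \<and>
      (\<forall>v \<in> set [0..<n]. same_entry \<Gamma> \<Gamma>' (u, v))) \<and> ([] :: bool list) = []"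
    by (rule concat_map_append_cancel[OF _ rows]) (rule encode_row_append_cancel)
  then have alice: "u < n \<Longrightarrow> u \<in> alice \<Gamma> \<longleftrightarrow> u \<in> alice \<Gamma>'"
    and entry: "u < n \<Longrightarrow> v < n \<Longrightarrow> same_entry \<Gamma> \<Gamma>' (u, v)" for u v
    by auto
  have players: "alice \<Gamma> \<union> bob \<Gamma> = {..<n}" "alice \<Gamma>' \<union> bob \<Gamma>' = {..<n}"
      "alice \<Gamma> \<inter> bob \<Gamma> = {}" "alice \<Gamma>' \<inter> bob \<Gamma>' = {}"
    using inst n nn by (auto simp: energy_instance_def weighted_game_graph_def)
  have arcs: "parcs (arena \<Gamma>) \<subseteq> {..<n} \<times> {..<n}" "parcs (arena \<Gamma>') \<subseteq> {..<n} \<times> {..<n}"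
    using inst n nn
    by (auto simp: energy_instance_def weighted_game_graph_def pair_fin_digraph_def
        dest: pair_wf_digraph.in_arcsD1 pair_wf_digraph.in_arcsD2)
  have "parcs (arena \<Gamma>) = parcs (arena \<Gamma>')"
    using arcs entry unfolding same_entry_def by fast
  then show "arena \<Gamma> = arena \<Gamma>'"
    using n nn by (simp add: pair_pre_digraph.equality)
  show A: "alice \<Gamma> = alice \<Gamma>'"
    using alice players by blast
  show "bob \<Gamma> = bob \<Gamma>'"
    using A players by blast
  show "s = s'" by (fact s)
  show "weight \<Gamma> e = weight \<Gamma>' e" if "e \<in> parcs (arena \<Gamma>)" for e
    using that arcs entry unfolding same_entry_def by (cases e) auto
qed


section \<open>The two decision problems\<close>

definition energy_problem :: decision_problem where
  "energy_problem =
     \<lparr> instances = encode ` {(\<Gamma>, s). energy_instance (\<Gamma>, s)},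
       yes_instances = encode ` {(\<Gamma>, s). energy_instance (\<Gamma>, s) \<and> minimal_energy \<Gamma> s < \<infinity>} \<rparr>"

definition complete_bipartite_energy_problem :: decision_problem where
  "complete_bipartite_energy_problem =
     \<lparr> instances = encode ` {(\<Gamma>, s). energy_instance (\<Gamma>, s) \<and> complete_bipartite_game \<Gamma>},
       yes_instances = encode ` {(\<Gamma>, s). energy_instance (\<Gamma>, s) \<and> complete_bipartite_game \<Gamma> \<and>
         minimal_energy \<Gamma> s < \<infinity>} \<rparr>"

end

theory Submission
  imports Defs
begin

text \<open>
  A complete bipartite game graph is an energy game, so one reduction is the identity. For the
  other, split every node \<open>u\<close> into a copy of Alice and a copy of Bob. The copy belonging to the
  owner of \<open>u\<close> has the arcs of \<open>u\<close>, leading to copies of the opponent; the other copy has a single arc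
  of weight 0 to its twin. The missing arcs between copies of different players are jumps: a jump
  home, that is to a copy of the given node \<open>s\<close>, costs its player \<open>K\<close>, and any other jump costs
  its player \<open>2 K\<close>, where \<open>K\<close> exceeds the absolute weight of every simple path of legal arcs.

  If Alice wins from \<open>s\<close>, then she can afford to jump home from wherever she does not win, since
  it was a jump of Bob, worth \<open>2 K\<close> to her, that brought her there. If she wins the complete
  bipartite game, her strategy uses no jump at a node reachable from \<open>s\<close> by legal moves: Bob would
  answer a jump that does not lead home by jumping home, which closes a cycle of negative weight.

  These arguments are carried out with energy progress measures, which exist exactly where Alice
  wins. As \<open>K\<close> one can take \<open>2 ^ L\<close> where \<open>L\<close> is the length of the input, whose binary code is
  easily written. The reduction is programmed in a while language over tapes that is compiled to
  Turing machines.
\<close>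


section \<open>Energy progress measures\<close>

text \<open>In a complete bipartite game the same player wins at all nodes: if Alice loses at one of
  her nodes, Bob can move there from each of his, and she can only move to nodes of Bob. So the
  question about \<open>s\<close> cannot be answered by a game that ignores \<open>s\<close>. The
  home node has to enter the weights, and a winner at \<open>s\<close> has to become a winner
  everywhere.

  This explains the two prices. With a single price, a jump of one player and the jump home of the
  other would cancel, and jumping would go unpunished. With \<open>2 * K\<close> against
  \<open>K\<close>, whoever first jumps elsewhere loses \<open>K\<close> in the exchange.

  Minimal energy speaks of the cycles of all pairs of strategies, whereas a measure is checked arc
  by arc, so it can be carried from one game to the other by naming values at the copies. The price
  is a positional argument for Bob: a strategy of Alice that is good against each of his positional
  strategies separately must yield one measure that respects all his moves at once.\<close>

text \<open>\<open>\<phi> u\<close> is an energy that suffices at \<open>u\<close>; \<open>\<infinity>\<close> marks the nodes where Alice may lose.\<close>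

definition covers :: "('v \<times> 'v \<Rightarrow> int) \<Rightarrow> ('v \<Rightarrow> enat) \<Rightarrow> 'v \<Rightarrow> 'v \<Rightarrow> bool" where
  "covers w \<phi> u v \<longleftrightarrow> (\<exists>a b. \<phi> u = enat a \<and> \<phi> v = enat b \<and> int b \<le> int a + w (u, v))"

text \<open>At nodes of Alice \<open>F\<close> will consist of the move of her strategy, at nodes of
  Bob of all his moves. Only universal conditions occur, so measures are closed under pointwise
  infima.\<close>

definition is_measure :: "('v \<Rightarrow> 'v set) \<Rightarrow> ('v \<times> 'v \<Rightarrow> int) \<Rightarrow> ('v \<Rightarrow> enat) \<Rightarrow> bool" where
  "is_measure F w \<phi> \<longleftrightarrow> (\<forall>u. \<phi> u \<noteq> \<infinity> \<longrightarrow> (\<forall>v \<in> F u. covers w \<phi> u v))"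

lemma is_measureD: "is_measure F w \<phi> \<Longrightarrow> \<phi> u \<noteq> \<infinity> \<Longrightarrow> v \<in> F u \<Longrightarrow> covers w \<phi> u v"
  by (simp add: is_measure_def)

lemma covers_shift:
  assumes "covers w \<phi> u v" "\<psi> u = \<phi> u + enat d" "\<psi> v \<le> \<phi> v + enat d"
  shows "covers w \<psi> u v"
  using assms unfolding covers_def by (cases "\<psi> v") auto

definition least_measure :: "('v \<Rightarrow> 'v set) \<Rightarrow> ('v \<times> 'v \<Rightarrow> int) \<Rightarrow> 'v \<Rightarrow> enat" where
  "least_measure F w u = (INF \<phi> \<in> Collect (is_measure F w). \<phi> u)"

lemma least_measure_le: "is_measure F w \<phi> \<Longrightarrow> least_measure F w u \<le> \<phi> u"
  by (auto simp: least_measure_def intro: INF_lower)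

text \<open>At \<open>u\<close> the infimum is attained by some measure, since \<open>enat\<close>
  is well-ordered, and at \<open>v\<close> it is at most the value of that measure.\<close>

lemma is_measure_least: "is_measure F w (least_measure F w)"
  unfolding is_measure_def
proof (intro allI impI ballI)
  fix u v assume "v \<in> F u" "least_measure F w u \<noteq> \<infinity>"
  have "is_measure F w (\<lambda>_. \<infinity>)"
    by (simp add: is_measure_def)
  then have "least_measure F w u \<in> (\<lambda>\<phi>. \<phi> u) ` Collect (is_measure F w)"
    unfolding least_measure_def by (intro wellorder_InfI) auto
  then obtain \<phi> where \<phi>: "is_measure F w \<phi>" "\<phi> u = least_measure F w u"
    by auto
  show "covers w (least_measure F w) u v"
    by (rule covers_shift[where \<phi> = \<phi> and d = 0])
      (use \<phi> \<open>v \<in> F u\<close> \<open>least_measure F w u \<noteq> \<infinity>\<close> in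
        \<open>auto simp: zero_enat_def[symmetric] intro: is_measureD least_measure_le\<close>)
qed

text \<open>
  A node \<open>u\<close> with several options is resolved by the option \<open>v\<close> whose least measure is largest
  at \<open>u\<close>: the least measure for \<open>v\<close> lies below that of any other option, shifted by the
  difference of the values at \<open>u\<close>, and hence respects that option as well.
\<close>

lemma measure_of_positional_measures:
  assumes "finite D" "\<And>u. u \<in> D \<Longrightarrow> finite (F u) \<and> F u \<noteq> {}"
    and "\<And>\<tau>'. (\<And>u. u \<notin> D \<Longrightarrow> \<tau>' u = \<tau> u) \<Longrightarrow> (\<And>u. u \<in> D \<Longrightarrow> \<tau>' u \<in> F u) \<Longrightarrow>
      \<exists>\<phi>. is_measure (\<lambda>u. {\<tau>' u}) w \<phi> \<and> \<phi> s \<noteq> \<infinity>"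
  shows "\<exists>\<phi>. is_measure (\<lambda>u. if u \<in> D then F u else {\<tau> u}) w \<phi> \<and> \<phi> s \<noteq> \<infinity>"
  using assms
proof (induction D arbitrary: \<tau> rule: finite_induct)
  case empty
  then show ?case by simp
next
  case (insert u D)
  \<comment> \<open>In \<open>G v\<close> the node \<open>u\<close> is tied to its option
    \<open>v\<close>, while all options stay open in \<open>D\<close>.\<close>
  define G where "G v = (\<lambda>x. if x \<in> D then F x else {(\<tau>(u := v)) x})" for v
  define \<phi> where "\<phi> v = least_measure (G v) w" for v
  have meas: "is_measure (G v) w (\<phi> v)" for v
    by (simp add: \<phi>_def is_measure_least)
  have fin: "\<phi> v s \<noteq> \<infinity>" if "v \<in> F u" for v
  proof -
    have "\<exists>\<psi>. is_measure (G v) w \<psi> \<and> \<psi> s \<noteq> \<infinity>"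
      unfolding G_def
    proof (rule insert.IH)
      show "\<exists>\<phi>. is_measure (\<lambda>u. {\<tau>' u}) w \<phi> \<and> \<phi> s \<noteq> \<infinity>"
        if "\<And>x. x \<notin> D \<Longrightarrow> \<tau>' x = (\<tau>(u := v)) x" "\<And>x. x \<in> D \<Longrightarrow> \<tau>' x \<in> F x" for \<tau>'
        using that \<open>v \<in> F u\<close> \<open>u \<notin> D\<close> by (intro insert.prems(2)) auto
    qed (use insert.prems in auto)
    then obtain \<psi> where "is_measure (G v) w \<psi>" "\<psi> s \<noteq> \<infinity>" by blast
    then show ?thesis
      using least_measure_le[of "G v" w \<psi> s] by (cases "least_measure (G v) w s") (auto simp: \<phi>_def)
  qed
  have "finite ((\<lambda>v. \<phi> v u) ` F u)" "(\<lambda>v. \<phi> v u) ` F u \<noteq> {}"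
    using insert.prems(1)[of u] by auto
  from Max_in[OF this] Max_ge[OF this(1)] obtain v
    where v: "v \<in> F u" and max: "\<And>v'. v' \<in> F u \<Longrightarrow> \<phi> v' u \<le> \<phi> v u"
    by auto
  have "is_measure (\<lambda>x. if x \<in> insert u D then F x else {\<tau> x}) w (\<phi> v)"
    unfolding is_measure_def
  proof (intro allI impI ballI)
    fix x y assume x: "\<phi> v x \<noteq> \<infinity>" and y: "y \<in> (if x \<in> insert u D then F x else {\<tau> x})"
    show "covers w (\<phi> v) x y"
    proof (cases "x = u")
      case False
      then have "y \<in> G v x"
        using y by (auto simp: G_def)
      then show ?thesis
        using meas x by (blast intro: is_measureD)
    next
      case True
      then have "y \<in> F u" using y by simp
      obtain a where a: "\<phi> v u = enat a" using x True by auto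
      with max[OF \<open>y \<in> F u\<close>] obtain b where b: "\<phi> y u = enat b" and "b \<le> a"
        by (cases "\<phi> y u") auto
      \<comment> \<open>The measure for \<open>y\<close> is lifted so that both measures have the
        value \<open>a\<close> at \<open>u\<close>. There the minimum follows
        \<open>\<phi> v\<close>, and away from \<open>u\<close> the conditions \<open>G v\<close>
        and \<open>G y\<close> coincide; so the minimum is again a measure for
        \<open>G v\<close>.\<close>
      define \<psi> where "\<psi> z = min (\<phi> v z) (\<phi> y z + enat (a - b))" for z
      have "is_measure (G v) w \<psi>"
        unfolding is_measure_def
      proof (intro allI impI ballI)
        fix p q assume p: "\<psi> p \<noteq> \<infinity>" and q: "q \<in> G v p"
        show "covers w \<psi> p q"
        proof (cases "p = u \<or> \<phi> v p \<le> \<phi> y p + enat (a - b)")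
          case True
          then have eq: "\<psi> p = \<phi> v p"
            using a b \<open>b \<le> a\<close> by (auto simp: \<psi>_def)
          have "covers w (\<phi> v) p q"
            using is_measureD[OF meas _ q] p eq by simp
          then show ?thesis
            by (rule covers_shift[where d = 0])
              (simp_all add: eq zero_enat_def[symmetric], simp add: \<psi>_def)
        next
          case False
          then have eq: "\<psi> p = \<phi> y p + enat (a - b)"
            by (auto simp: \<psi>_def min_def)
          from False q have "q \<in> G y p"
            by (auto simp: G_def split: if_splits)
          then have "covers w (\<phi> y) p q"
            using is_measureD[OF meas] p eq by (metis plus_enat_simps(2))
          then show ?thesis
            by (rule covers_shift[where d = "a - b"]) (simp add: eq, simp add: \<psi>_def)
        qed
      qed
      \<comment> \<open>Leastness of \<open>\<phi> v\<close> bounds it at \<open>y\<close> by the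
        lifted \<open>\<phi> y\<close>, which respects the arc from \<open>u\<close> to
        \<open>y\<close>.\<close>
      then have "\<phi> v y \<le> \<psi> y"
        unfolding \<phi>_def by (rule least_measure_le)
      then have "\<phi> v y \<le> \<phi> y y + enat (a - b)"
        by (simp add: \<psi>_def)
      moreover have "covers w (\<phi> y) u y"
      proof (rule is_measureD[OF meas])
        show "y \<in> G y u"
          using insert.hyps(2) by (simp add: G_def)
      qed (simp add: b)
      ultimately show ?thesis
        unfolding True
        by (intro covers_shift[where \<phi> = "\<phi> y" and d = "a - b" and \<psi> = "\<phi> v"])
          (simp_all add: a b \<open>b \<le> a\<close>)
    qed
  qed
  with fin[OF v] show ?case by blast
qed

section \<open>Plays between two positional strategies as orbits of a function\<close>

definition orbit_weight :: "('v \<Rightarrow> 'v) \<Rightarrow> ('v \<times> 'v \<Rightarrow> int) \<Rightarrow> 'v \<Rightarrow> nat \<Rightarrow> int" where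
  "orbit_weight f w u k = (\<Sum>i<k. w ((f ^^ i) u, (f ^^ Suc i) u))"

lemma funpow_funpow: "(f ^^ k) ((f ^^ j) u) = (f ^^ (j + k)) u"
  by (simp add: funpow_add add.commute[of j])

lemma orbit_weight_add:
  "orbit_weight f w u (j + k) = orbit_weight f w u j + orbit_weight f w ((f ^^ j) u) k"
  by (induction k) (simp_all add: orbit_weight_def funpow_funpow)

text \<open>Cutting the first cycle, of nonnegative weight, out of a prefix of the orbit does not
  raise its weight. So the finitely many prefixes shorter than the first repetition determine a
  lower bound.\<close>

lemma orbit_weight_bounded_below:
  assumes "finite V" "f ` V \<subseteq> V" "s \<in> V"
    and cycles: "\<And>m p. 0 < p \<Longrightarrow> (f ^^ p) ((f ^^ m) s) = (f ^^ m) s \<Longrightarrow>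
      inj_on (\<lambda>i. (f ^^ i) ((f ^^ m) s)) {..<p} \<Longrightarrow> 0 \<le> orbit_weight f w ((f ^^ m) s) p"
  shows "\<exists>M :: nat. \<forall>k. - int M \<le> orbit_weight f w s k"
proof -
  have orbit: "(f ^^ i) s \<in> V" for i
    using assms(2,3) by (induction i) auto
  then have "finite (range (\<lambda>i. (f ^^ i) s))"
    by (intro finite_subset[OF _ \<open>finite V\<close>]) blast
  then have "\<not> inj (\<lambda>i. (f ^^ i) s)"
    using finite_imageD infinite_UNIV_nat by blast
  then have ex: "\<exists>j. \<exists>i<j. (f ^^ i) s = (f ^^ j) s"
    by (meson linorder_injI)
  \<comment> \<open>Minimality of \<open>j\<close> makes the cycle between the positions
    \<open>m\<close> and \<open>j\<close> simple, as \<open>cycles\<close> demands.\<close>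
  define j where "j = (LEAST j. \<exists>i<j. (f ^^ i) s = (f ^^ j) s)"
  obtain m where "m < j" and m: "(f ^^ m) s = (f ^^ j) s"
    using LeastI_ex[OF ex] unfolding j_def by blast
  have least: "\<not> (f ^^ a) s = (f ^^ b) s" if "a < b" "b < j" for a b
    using not_less_Least[of b "\<lambda>j. \<exists>i<j. (f ^^ i) s = (f ^^ j) s"] that unfolding j_def by blast
  define p where "p = j - m"
  have j: "j = m + p" and "0 < p"
    using \<open>m < j\<close> by (auto simp: p_def)
  have "inj_on (\<lambda>i. (f ^^ i) ((f ^^ m) s)) {..<p}"
  proof (rule linorder_inj_onI')
    fix a b assume "a \<in> {..<p}" "b \<in> {..<p}" "a < b"
    then show "(f ^^ a) ((f ^^ m) s) \<noteq> (f ^^ b) ((f ^^ m) s)"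
      using least[of "m + a" "m + b"] j by (simp add: funpow_funpow)
  qed
  moreover have "(f ^^ p) ((f ^^ m) s) = (f ^^ m) s"
    using funpow_funpow[of p f m s] m by (simp only: j)
  ultimately have nonneg: "0 \<le> orbit_weight f w ((f ^^ m) s) p"
    using cycles[OF \<open>0 < p\<close>] by blast
  have descent: "orbit_weight f w s (m + k) \<le> orbit_weight f w s (j + k)" for k
    using nonneg m by (simp add: orbit_weight_add j)
  define M where "M = (\<Sum>i<j. \<bar>w ((f ^^ i) s, (f ^^ Suc i) s)\<bar>)"
  have "- M \<le> orbit_weight f w s k" for k
  proof (induction k rule: less_induct)
    case (less k)
    show ?case
    proof (cases "k < j")
      case True
      have "\<bar>orbit_weight f w s k\<bar> \<le> (\<Sum>i<k. \<bar>w ((f ^^ i) s, (f ^^ Suc i) s)\<bar>)"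
        unfolding orbit_weight_def by (rule sum_abs)
      also have "\<dots> \<le> M"
        unfolding M_def using True by (intro sum_mono2) auto
      finally show ?thesis by simp
    next
      case False
      then have "- M \<le> orbit_weight f w s (m + (k - j))"
        using \<open>m < j\<close> by (intro less.IH) auto
      also have "\<dots> \<le> orbit_weight f w s k"
        using descent[of "k - j"] False by simp
      finally show ?thesis .
    qed
  qed
  moreover have "0 \<le> M"
    by (simp add: M_def sum_nonneg)
  ultimately have "\<forall>k. - int (nat M) \<le> orbit_weight f w s k"
    by simp
  then show ?thesis by blast
qed

text \<open>The measure is the least initial energy with which the play from \<open>u\<close> never
  drops below zero. That energy plus the weight of the first arc is enough for the play from
  \<open>f u\<close>.\<close>

lemma measure_of_orbit:
  assumes "\<exists>M :: nat. \<forall>k. - int M \<le> orbit_weight f w s k"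
  shows "\<exists>\<phi>. is_measure (\<lambda>u. {f u}) w \<phi> \<and> \<phi> s \<noteq> \<infinity>"
proof -
  define bounds where "bounds u M \<longleftrightarrow> (\<forall>k. - int M \<le> orbit_weight f w u k)" for u M
  define \<phi> where "\<phi> u = (if \<exists>M. bounds u M then enat (LEAST M. bounds u M) else \<infinity>)" for u
  have "covers w \<phi> u (f u)" if "\<phi> u \<noteq> \<infinity>" for u
  proof -
    from that have ex: "\<exists>M. bounds u M" and "\<phi> u = enat (LEAST M. bounds u M)"
      by (auto simp: \<phi>_def split: if_splits)
    then obtain a where a: "\<phi> u = enat a" "bounds u a"
      using LeastI_ex[OF ex] by blast
    have first: "orbit_weight f w u (Suc k) = w (u, f u) + orbit_weight f w (f u) k" for k
      using orbit_weight_add[of f w u 1 k] by (simp add: orbit_weight_def)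
    have "0 \<le> int a + w (u, f u)"
      using a(2)[unfolded bounds_def, rule_format, of 1] first[of 0]
      by (simp add: orbit_weight_def)
    moreover have "bounds (f u) (nat (int a + w (u, f u)))"
      unfolding bounds_def
    proof
      fix k
      show "- int (nat (int a + w (u, f u))) \<le> orbit_weight f w (f u) k"
        using a(2)[unfolded bounds_def, rule_format, of "Suc k"] first[of k] calculation by simp
    qed
    then have "\<phi> (f u) = enat (LEAST M. bounds (f u) M)"
      "(LEAST M. bounds (f u) M) \<le> nat (int a + w (u, f u))"
      by (auto simp: \<phi>_def intro: Least_le)
    ultimately show ?thesis
      unfolding covers_def using a(1) by auto
  qed
  then have "is_measure (\<lambda>u. {f u}) w \<phi>"
    by (simp add: is_measure_def)
  moreover have "\<phi> s \<noteq> \<infinity>"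
    using assms by (auto simp: \<phi>_def bounds_def)
  ultimately show ?thesis by blast
qed

section \<open>Energy measures characterise finite minimal energy\<close>

definition energy_measure :: "'v weighted_game \<Rightarrow> ('v \<Rightarrow> enat) \<Rightarrow> bool" where
  "energy_measure \<Gamma> \<phi> \<longleftrightarrow>
     (\<forall>u \<in> alice \<Gamma>. \<phi> u \<noteq> \<infinity> \<longrightarrow> (\<exists>v. (u, v) \<in> parcs (arena \<Gamma>) \<and> covers (weight \<Gamma>) \<phi> u v)) \<and>
     (\<forall>u \<in> bob \<Gamma>. \<phi> u \<noteq> \<infinity> \<longrightarrow> (\<forall>v. (u, v) \<in> parcs (arena \<Gamma>) \<longrightarrow> covers (weight \<Gamma>) \<phi> u v))"

definition has_bad_cycle :: "'v weighted_game \<Rightarrow> ('v \<Rightarrow> 'v) \<Rightarrow> ('v \<Rightarrow> 'v) \<Rightarrow> 'v \<Rightarrow> bool" where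
  "has_bad_cycle \<Gamma> \<sigma> \<tau> s \<longleftrightarrow> (\<exists>C. pre_digraph.cycle (with_proj (strategy_graph \<Gamma> \<sigma> \<tau>)) C \<and>
     s \<rightarrow>\<^sup>*\<^bsub>with_proj (strategy_graph \<Gamma> \<sigma> \<tau>)\<^esub> fst (hd C) \<and> path_weight \<Gamma> C < 0)"

text \<open>The other branch of \<open>play_energy\<close> is a natural number whatever the path
  weights are, so the cycle alone decides.\<close>

lemma play_energy_finite_iff: "play_energy \<Gamma> \<sigma> \<tau> s < \<infinity> \<longleftrightarrow> \<not> has_bad_cycle \<Gamma> \<sigma> \<tau> s"
  by (auto simp: play_energy_def has_bad_cycle_def Let_def)

lemma strategies_finite_nonempty:
  assumes "weighted_game_graph \<Gamma>" "U \<subseteq> pverts (arena \<Gamma>)"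
  shows "finite (strategies \<Gamma> U)" "strategies \<Gamma> U \<noteq> {}"
proof -
  interpret pair_fin_digraph "arena \<Gamma>"
    using assms(1) by (simp add: weighted_game_graph_def)
  have "finite {v. (u, v) \<in> parcs (arena \<Gamma>)}" for u
    by (rule finite_subset[OF _ pair_finite_verts]) (auto dest: in_arcsD2)
  then show "finite (strategies \<Gamma> U)"
    unfolding strategies_def using assms(2) pair_finite_verts
    by (intro finite_PiE) (auto intro: finite_subset)
  show "strategies \<Gamma> U \<noteq> {}"
    using assms by (auto simp: strategies_def PiE_eq_empty_iff weighted_game_graph_def)
qed

lemma minimal_energy_finite_iff_strategies:
  assumes "weighted_game_graph \<Gamma>"
  shows "minimal_energy \<Gamma> s < \<infinity> \<longleftrightarrow>
    (\<exists>\<sigma> \<in> strategies \<Gamma> (alice \<Gamma>). \<forall>\<tau> \<in> strategies \<Gamma> (bob \<Gamma>). \<not> has_bad_cycle \<Gamma> \<sigma> \<tau> s)"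
proof -
  have "alice \<Gamma> \<subseteq> pverts (arena \<Gamma>)" "bob \<Gamma> \<subseteq> pverts (arena \<Gamma>)"
    using assms by (auto simp: weighted_game_graph_def)
  note strategies_finite_nonempty[OF assms this(1)] strategies_finite_nonempty[OF assms this(2)]
  then show ?thesis
    by (simp add: minimal_energy_def Min_less_iff Max_less_iff play_energy_finite_iff
        del: enat_ord_simps not_infinity_eq)
qed

lemma covers_walk:
  assumes "pcas u p v" "\<phi> u \<noteq> \<infinity>"
    and "\<And>x y. (x, y) \<in> set p \<Longrightarrow> \<phi> x \<noteq> \<infinity> \<Longrightarrow> covers (weight \<Gamma>) \<phi> x y"
  shows "\<exists>a b. \<phi> u = enat a \<and> \<phi> v = enat b \<and> int b \<le> int a + path_weight \<Gamma> p"
  using assms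
proof (induction p arbitrary: u)
  case Nil
  then show ?case by (auto simp: path_weight_def)
next
  case (Cons e p)
  obtain x where e: "e = (u, x)"
    using Cons.prems(1) by (cases e) auto
  have "covers (weight \<Gamma>) \<phi> u x"
    using Cons.prems(2,3) by (simp add: e)
  then obtain a b where ab: "\<phi> u = enat a" "\<phi> x = enat b" "int b \<le> int a + weight \<Gamma> (u, x)"
    by (auto simp: covers_def)
  moreover have "\<exists>a b. \<phi> x = enat a \<and> \<phi> v = enat b \<and> int b \<le> int a + path_weight \<Gamma> p"
    using Cons.prems ab e by (intro Cons.IH) auto
  ultimately show ?case
    by (fastforce simp: path_weight_def e)
qed

lemma reachable_covers:
  assumes "s \<rightarrow>\<^sup>*\<^bsub>with_proj H\<^esub> v" "\<phi> s \<noteq> \<infinity>"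
    and "\<And>x y. (x, y) \<in> parcs H \<Longrightarrow> \<phi> x \<noteq> \<infinity> \<Longrightarrow> covers w \<phi> x y"
  shows "\<phi> v \<noteq> \<infinity>"
proof -
  have "(s, v) \<in> (parcs H)\<^sup>*"
    using reachable_rtranclI[OF assms(1)] by simp
  then show ?thesis
    using assms(2,3) by (induction rule: rtrancl_induct) (auto simp: covers_def)
qed

text \<open>Finiteness of \<open>\<phi>\<close> spreads from \<open>s\<close> along the arcs. Adding
  up the inequalities of \<open>covers\<close> around a cycle leads back to the same finite value,
  so its weight is not negative.\<close>

lemma measure_no_bad_cycle:
  assumes "\<phi> s \<noteq> \<infinity>"
    and covers: "\<And>x y. (x, y) \<in> parcs (strategy_graph \<Gamma> \<sigma> \<tau>) \<Longrightarrow> \<phi> x \<noteq> \<infinity> \<Longrightarrow>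
      covers (weight \<Gamma>) \<phi> x y"
  shows "\<not> has_bad_cycle \<Gamma> \<sigma> \<tau> s"
proof
  let ?H = "strategy_graph \<Gamma> \<sigma> \<tau>"
  assume "has_bad_cycle \<Gamma> \<sigma> \<tau> s"
  then obtain C u where C: "pre_digraph.awalk (with_proj ?H) u C u" "C \<noteq> []"
    and reach: "s \<rightarrow>\<^sup>*\<^bsub>with_proj ?H\<^esub> fst (hd C)" and neg: "path_weight \<Gamma> C < 0"
    by (auto simp: has_bad_cycle_def pre_digraph.cycle_def)
  have arcs: "set C \<subseteq> parcs ?H" and cas: "pcas u C u"
    using C by (auto simp: pre_digraph.awalk_def cas_with_proj_eq)
  from cas \<open>C \<noteq> []\<close> have "fst (hd C) = u"
    by (cases C) auto
  then have "\<phi> u \<noteq> \<infinity>"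
    using reachable_covers[OF reach assms] by simp
  then have "\<exists>a b. \<phi> u = enat a \<and> \<phi> u = enat b \<and> int b \<le> int a + path_weight \<Gamma> C"
    by (intro covers_walk cas) (use arcs covers in blast)+
  with neg show False by auto
qed

lemma pcas_orbit: "pcas c (map (\<lambda>i. ((f ^^ i) c, (f ^^ Suc i) c)) [0..<p]) ((f ^^ p) c)"
proof (induction p arbitrary: c)
  case 0
  then show ?case by simp
next
  case (Suc p)
  show ?case
    using Suc.IH[of "f c"] unfolding upt_conv_Cons[OF zero_less_Suc] map_Suc_upt[symmetric]
    by (simp add: funpow_swap1 comp_def del: upt_Suc)
qed

lemma pawalk_verts_orbit:
  "pawalk_verts c (map (\<lambda>i. ((f ^^ i) c, (f ^^ Suc i) c)) [0..<p]) = map (\<lambda>i. (f ^^ i) c) [0..<Suc p]"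
proof (induction p arbitrary: c)
  case 0
  then show ?case by simp
next
  case (Suc p)
  show ?case
    using Suc.IH[of "f c"] unfolding upt_conv_Cons[OF zero_less_Suc] map_Suc_upt[symmetric]
    by (simp add: funpow_swap1 comp_def del: upt_Suc)
qed

lemma bad_cycle_of_orbit:
  assumes f: "f = (\<lambda>u. if u \<in> alice \<Gamma> then \<sigma> u else \<tau> u)"
    and wf: "alice \<Gamma> \<union> bob \<Gamma> = pverts (arena \<Gamma>)" "alice \<Gamma> \<inter> bob \<Gamma> = {}"
    and closed: "f ` pverts (arena \<Gamma>) \<subseteq> pverts (arena \<Gamma>)" and s: "s \<in> pverts (arena \<Gamma>)"
    and "0 < p" and period: "(f ^^ p) ((f ^^ m) s) = (f ^^ m) s"
    and inj: "inj_on (\<lambda>i. (f ^^ i) ((f ^^ m) s)) {..<p}"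
    and neg: "orbit_weight f (weight \<Gamma>) ((f ^^ m) s) p < 0"
  shows "has_bad_cycle \<Gamma> \<sigma> \<tau> s"
proof -
  let ?H = "strategy_graph \<Gamma> \<sigma> \<tau>"
  have arc: "(u, f u) \<in> parcs ?H" if "u \<in> pverts (arena \<Gamma>)" for u
    using that wf by (auto simp: strategy_graph_def f)
  interpret H: pair_wf_digraph ?H
  proof
    fix e assume "e \<in> parcs ?H"
    then have "fst e \<in> pverts (arena \<Gamma>)" "snd e = f (fst e)"
      using wf by (auto simp: strategy_graph_def f)
    then show "fst e \<in> pverts ?H" "snd e \<in> pverts ?H"
      using closed by (auto simp: strategy_graph_def)
  qed
  have orbit: "(f ^^ i) s \<in> pverts (arena \<Gamma>)" for i
    using closed s by (induction i) auto
  have reach: "s \<rightarrow>\<^sup>*\<^bsub>with_proj ?H\<^esub> (f ^^ i) s" for i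
  proof (induction i)
    case 0
    have "s \<in> pverts ?H"
      using s by (simp add: strategy_graph_def)
    then show ?case by simp
  next
    case (Suc i)
    moreover have "((f ^^ i) s, (f ^^ Suc i) s) \<in> parcs ?H"
      using arc[OF orbit[of i]] by simp
    ultimately show ?case by (rule H.reachable_adj_trans)
  qed
  define c where "c = (f ^^ m) s"
  define C where "C = map (\<lambda>i. ((f ^^ i) c, (f ^^ Suc i) c)) [0..<p]"
  have c_orbit: "(f ^^ i) c \<in> pverts (arena \<Gamma>)" for i
    using orbit[of "i + m"] by (simp add: c_def funpow_add)
  have "set C \<subseteq> parcs ?H"
    using arc[OF c_orbit] by (auto simp: C_def)
  moreover have "c \<in> pverts ?H"
    using orbit by (simp add: c_def strategy_graph_def)
  ultimately have "pre_digraph.awalk (with_proj ?H) c C c"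
    using pcas_orbit[where f = f and p = p and c = c] period
    by (simp add: pre_digraph.awalk_def cas_with_proj_eq C_def c_def)
  moreover have "distinct (tl (pawalk_verts c C))"
  proof -
    \<comment> \<open>A cycle lists its first node again at the end, and distinctness is required of
      the tail; so position \<open>p\<close> takes the place of position 0.\<close>
    have "inj_on (\<lambda>i. (f ^^ i) c) {1..p}"
    proof (rule linorder_inj_onI')
      fix i j assume ij: "i \<in> {1..p}" "j \<in> {1..p}" "i < j"
      show "(f ^^ i) c \<noteq> (f ^^ j) c"
      proof (cases "j = p")
        case True
        then have "(f ^^ j) c = (f ^^ 0) c"
          using period by (simp add: c_def)
        then show ?thesis
          using inj_onD[OF inj, of i 0] ij by (auto simp: c_def)
      next
        case False
        then show ?thesis
          using inj_onD[OF inj, of i j] ij by (auto simp: c_def)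
      qed
    qed
    moreover have "tl (pawalk_verts c C) = map (\<lambda>i. (f ^^ i) c) [1..<Suc p]"
      unfolding C_def pawalk_verts_orbit by (simp add: map_tl[symmetric] tl_upt del: upt_Suc)
    moreover have "set [1..<Suc p] = {1..p}" by auto
    ultimately show ?thesis
      by (simp add: distinct_map del: upt_Suc)
  qed
  moreover have "C \<noteq> []" "fst (hd C) = c"
    using \<open>0 < p\<close> by (auto simp: C_def hd_map)
  moreover have "path_weight \<Gamma> C = orbit_weight f (weight \<Gamma>) c p"
    by (simp add: path_weight_def C_def orbit_weight_def comp_def interv_sum_list_conv_sum_set_nat
        atLeast0LessThan)
  ultimately show ?thesis
    using reach[of m] neg unfolding has_bad_cycle_def pre_digraph.cycle_def
    by (metis awalk_verts_with_proj_eq c_def)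
qed

text \<open>From left to right, a winning strategy of Alice leaves one orbit without negative cycles
  for each positional answer of Bob. Each orbit has a measure, and
  \<open>measure_of_positional_measures\<close> merges them. From right to left, Alice follows arcs
  that the measure covers.\<close>

theorem minimal_energy_finite_iff:
  assumes wf: "weighted_game_graph \<Gamma>" and s: "s \<in> pverts (arena \<Gamma>)"
  shows "minimal_energy \<Gamma> s < \<infinity> \<longleftrightarrow> (\<exists>\<phi>. energy_measure \<Gamma> \<phi> \<and> \<phi> s \<noteq> \<infinity>)"
proof
  interpret pair_fin_digraph "arena \<Gamma>"
    using wf by (simp add: weighted_game_graph_def)
  have players: "alice \<Gamma> \<union> bob \<Gamma> = pverts (arena \<Gamma>)" "alice \<Gamma> \<inter> bob \<Gamma> = {}"
    using wf by (auto simp: weighted_game_graph_def)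
  {
    assume "minimal_energy \<Gamma> s < \<infinity>"
    then obtain \<sigma> where \<sigma>: "\<sigma> \<in> strategies \<Gamma> (alice \<Gamma>)"
      and good: "\<And>\<tau>. \<tau> \<in> strategies \<Gamma> (bob \<Gamma>) \<Longrightarrow> \<not> has_bad_cycle \<Gamma> \<sigma> \<tau> s"
      using minimal_energy_finite_iff_strategies[OF wf] by blast
    let ?F = "\<lambda>u. if u \<in> bob \<Gamma> then {v. (u, v) \<in> parcs (arena \<Gamma>)} else {\<sigma> u}"
    have "\<exists>\<phi>. is_measure ?F (weight \<Gamma>) \<phi> \<and> \<phi> s \<noteq> \<infinity>"
    proof (rule measure_of_positional_measures)
      show "finite (bob \<Gamma>)"
        using pair_finite_verts players by (auto intro: finite_subset)
      show "finite {v. (u, v) \<in> parcs (arena \<Gamma>)} \<and> {v. (u, v) \<in> parcs (arena \<Gamma>)} \<noteq> {}"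
        if "u \<in> bob \<Gamma>" for u
        using that wf finite_subset[OF _ pair_finite_verts, of "{v. (u, v) \<in> parcs (arena \<Gamma>)}"]
        by (auto simp: weighted_game_graph_def dest: in_arcsD2)
      fix f assume f\<sigma>: "\<And>u. u \<notin> bob \<Gamma> \<Longrightarrow> f u = \<sigma> u"
        and f\<tau>: "\<And>u. u \<in> bob \<Gamma> \<Longrightarrow> f u \<in> {v. (u, v) \<in> parcs (arena \<Gamma>)}"
      have \<tau>: "restrict f (bob \<Gamma>) \<in> strategies \<Gamma> (bob \<Gamma>)"
        using f\<tau> by (auto simp: strategies_def)
      \<comment> \<open>Strategies are extensional, so the strategy of Bob is \<open>f\<close> cut
        down to \<open>bob \<Gamma>\<close>. The resulting successor function \<open>g\<close>
        agrees with \<open>f\<close> on the nodes of the game.\<close>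
      define g where "g = (\<lambda>u. if u \<in> alice \<Gamma> then \<sigma> u else restrict f (bob \<Gamma>) u)"
      have succ: "(u, f u) \<in> parcs (arena \<Gamma>)" if "u \<in> pverts (arena \<Gamma>)" for u
        using that \<sigma> f\<sigma> f\<tau> players by (cases "u \<in> bob \<Gamma>") (auto simp: strategies_def)
      have eq: "g u = f u" if "u \<in> pverts (arena \<Gamma>)" for u
        using that f\<sigma> players by (auto simp: g_def)
      have closed: "g ` pverts (arena \<Gamma>) \<subseteq> pverts (arena \<Gamma>)"
        using succ eq by (auto dest: in_arcsD2)
      have closed': "f ` pverts (arena \<Gamma>) \<subseteq> pverts (arena \<Gamma>)"
        using succ by (auto dest: in_arcsD2)
      have pow: "(g ^^ i) u = (f ^^ i) u \<and> (f ^^ i) u \<in> pverts (arena \<Gamma>)"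
        if "u \<in> pverts (arena \<Gamma>)" for i u
        using that closed' by (induction i) (auto simp: eq)
      show "\<exists>\<phi>. is_measure (\<lambda>u. {f u}) (weight \<Gamma>) \<phi> \<and> \<phi> s \<noteq> \<infinity>"
      proof (intro measure_of_orbit orbit_weight_bounded_below[OF pair_finite_verts closed' s])
        fix m p assume p: "0 < p" "(f ^^ p) ((f ^^ m) s) = (f ^^ m) s"
          "inj_on (\<lambda>i. (f ^^ i) ((f ^^ m) s)) {..<p}"
        let ?c = "(f ^^ m) s"
        have c: "?c \<in> pverts (arena \<Gamma>)" "(g ^^ m) s = ?c"
          using pow[OF s] by auto
        show "0 \<le> orbit_weight f (weight \<Gamma>) ?c p"
        proof (rule ccontr)
          assume "\<not> ?thesis"
          then have "orbit_weight g (weight \<Gamma>) ?c p < 0"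
            using pow[OF c(1)] unfolding orbit_weight_def by presburger
          then have "has_bad_cycle \<Gamma> \<sigma> (restrict f (bob \<Gamma>)) s"
            using p pow[OF c(1)] c by (intro bad_cycle_of_orbit[OF g_def players closed s p(1), of m]) simp_all
          with good[OF \<tau>] show False by blast
        qed
      qed
    qed
    then obtain \<phi> where \<phi>: "is_measure ?F (weight \<Gamma>) \<phi>" "\<phi> s \<noteq> \<infinity>"
      by blast
    have "energy_measure \<Gamma> \<phi>"
      unfolding energy_measure_def
    proof (intro conjI ballI impI allI)
      show "\<exists>v. (u, v) \<in> parcs (arena \<Gamma>) \<and> covers (weight \<Gamma>) \<phi> u v"
        if u: "u \<in> alice \<Gamma>" "\<phi> u \<noteq> \<infinity>" for u
      proof -
        have "u \<notin> bob \<Gamma>"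
          using u players by blast
        then have "covers (weight \<Gamma>) \<phi> u (\<sigma> u)"
          using is_measureD[OF \<phi>(1) u(2), of "\<sigma> u"] by simp
        then show ?thesis
          using u \<sigma> by (auto simp: strategies_def)
      qed
      show "covers (weight \<Gamma>) \<phi> u v"
        if "u \<in> bob \<Gamma>" "\<phi> u \<noteq> \<infinity>" "(u, v) \<in> parcs (arena \<Gamma>)" for u v
        using that is_measureD[OF \<phi>(1), of u v] by auto
    qed
    with \<phi>(2) show "\<exists>\<phi>. energy_measure \<Gamma> \<phi> \<and> \<phi> s \<noteq> \<infinity>" by blast
  next
    assume "\<exists>\<phi>. energy_measure \<Gamma> \<phi> \<and> \<phi> s \<noteq> \<infinity>"
    then obtain \<phi> where \<phi>: "energy_measure \<Gamma> \<phi>" "\<phi> s \<noteq> \<infinity>" by blast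
    \<comment> \<open>At nodes of value \<infinity> every arc is accepted, because a strategy must
      name a legal move there as well.\<close>
    define good where "good u v \<longleftrightarrow> (u, v) \<in> parcs (arena \<Gamma>) \<and>
      (\<phi> u \<noteq> \<infinity> \<longrightarrow> covers (weight \<Gamma>) \<phi> u v)" for u v
    define \<sigma> where "\<sigma> = restrict (\<lambda>u. SOME v. good u v) (alice \<Gamma>)"
    have \<sigma>: "good u (\<sigma> u)" if "u \<in> alice \<Gamma>" for u
    proof -
      have "\<exists>v. good u v"
        using that \<phi> wf players by (cases "\<phi> u = \<infinity>")
          (auto simp: good_def energy_measure_def weighted_game_graph_def)
      then show ?thesis
        using that by (simp add: \<sigma>_def someI_ex)
    qed
    then have "\<sigma> \<in> strategies \<Gamma> (alice \<Gamma>)"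
      by (auto simp: strategies_def good_def \<sigma>_def)
    moreover have "\<not> has_bad_cycle \<Gamma> \<sigma> \<tau> s" if "\<tau> \<in> strategies \<Gamma> (bob \<Gamma>)" for \<tau>
    proof (rule measure_no_bad_cycle[where \<phi> = \<phi>])
      show "\<phi> s \<noteq> \<infinity>" by (fact \<phi>(2))
    next
      fix x y assume "(x, y) \<in> parcs (strategy_graph \<Gamma> \<sigma> \<tau>)" and x: "\<phi> x \<noteq> \<infinity>"
      then consider "x \<in> alice \<Gamma>" "y = \<sigma> x" | "x \<in> bob \<Gamma>" "y = \<tau> x"
        by (auto simp: strategy_graph_def)
      then show "covers (weight \<Gamma>) \<phi> x y"
      proof cases
        case 1
        then show ?thesis using \<sigma> x by (auto simp: good_def)
      next
        case 2
        then show ?thesis using that \<phi>(1) x by (auto simp: energy_measure_def strategies_def)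
      qed
    qed
    ultimately show "minimal_energy \<Gamma> s < \<infinity>"
      using minimal_energy_finite_iff_strategies[OF wf] by blast
  }
qed


section \<open>Reduction to complete bipartite games\<close>

text \<open>Gaps of more than \<open>W\<close> between consecutive values of a measure can be shortened to \<open>W\<close>.\<close>

definition compress :: "'v set \<Rightarrow> nat \<Rightarrow> ('v \<Rightarrow> enat) \<Rightarrow> 'v \<Rightarrow> enat" where
  "compress V W \<phi> u = (case \<phi> u of \<infinity> \<Rightarrow> \<infinity> | enat a \<Rightarrow>
     enat (card {j. j < a \<and> (\<exists>x \<in> V. \<exists>b. \<phi> x = enat b \<and> j < b \<and> b \<le> j + W)}))"

lemma compress_eq_infinity_iff: "compress V W \<phi> u = \<infinity> \<longleftrightarrow> \<phi> u = \<infinity>"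
  by (simp add: compress_def split: enat.split)

text \<open>Each finite value on \<open>V\<close> contributes at most the \<open>W\<close> numbers
  just below it. Bounding all finite values in this way allows the price of jumps to be fixed
  beforehand.\<close>

lemma compress_le:
  assumes "finite V" "compress V W \<phi> u = enat a"
  shows "a \<le> card V * W"
proof -
  define B where "B x = (case \<phi> x of \<infinity> \<Rightarrow> {} | enat b \<Rightarrow> {b - W..<b})" for x
  have B: "finite (B x)" "card (B x) \<le> W" for x
    by (auto simp: B_def split: enat.split)
  obtain c where "a = card {j. j < c \<and> (\<exists>x \<in> V. \<exists>b. \<phi> x = enat b \<and> j < b \<and> b \<le> j + W)}"
    using assms(2) by (auto simp: compress_def split: enat.splits)
  also have "\<dots> \<le> card (\<Union>x\<in>V. B x)"
    using assms(1) B by (intro card_mono) (force simp: B_def)+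
  also have "\<dots> \<le> (\<Sum>x\<in>V. card (B x))"
    by (rule card_UN_le[OF assms(1)])
  also have "\<dots> \<le> card V * W"
    using B sum_bounded_above[of V "\<lambda>x. card (B x)" W] by simp
  finally show ?thesis .
qed

text \<open>If the weight is nonnegative, passing from \<open>a\<close> to \<open>b\<close> adds at
  most \<open>b - a\<close> counted numbers. If it is \<open>- d\<close>, the \<open>d\<close>
  numbers just below \<open>a\<close> are all counted, as \<open>d \<le> W\<close>, and none of them
  is below \<open>b\<close>.\<close>

lemma covers_compress:
  assumes cov: "covers w \<phi> u v" and V: "u \<in> V" and W: "\<bar>w (u, v)\<bar> \<le> int W"
  shows "covers w (compress V W \<phi>) u v"
proof -
  define S where "S = {j. \<exists>x \<in> V. \<exists>b. \<phi> x = enat b \<and> j < b \<and> b \<le> j + W}"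
  obtain a b where a: "\<phi> u = enat a" and b: "\<phi> v = enat b" and le: "int b \<le> int a + w (u, v)"
    using cov by (auto simp: covers_def)
  have eq: "{j. j < c \<and> (\<exists>x \<in> V. \<exists>b. \<phi> x = enat b \<and> j < b \<and> b \<le> j + W)} = S \<inter> {..<c}" for c
    by (auto simp: S_def)
  have "int (card (S \<inter> {..<b})) \<le> int (card (S \<inter> {..<a})) + w (u, v)"
  proof (cases "0 \<le> w (u, v)")
    case True
    have "card (S \<inter> {..<b}) \<le> card (S \<inter> {..<a} \<union> {a..<b})"
      by (rule card_mono) auto
    also have "\<dots> \<le> card (S \<inter> {..<a}) + (b - a)"
      using card_Un_le[of "S \<inter> {..<a}" "{a..<b}"] by simp
    finally show ?thesis using le True by linarith
  next
    case False
    define d where "d = nat (- w (u, v))"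
    have d: "int d = - w (u, v)" "d \<le> W" "b + d \<le> a"
      using False W le by (auto simp: d_def)
    have "{a - d..<a} \<subseteq> S"
      using V a d by (auto simp: S_def intro!: bexI[of _ u])
    then have "card (S \<inter> {..<b} \<union> {a - d..<a}) \<le> card (S \<inter> {..<a})"
      using d by (intro card_mono) auto
    moreover have "S \<inter> {..<b} \<inter> {a - d..<a} = {}"
      using d(3) by auto
    then have "card (S \<inter> {..<b} \<union> {a - d..<a}) = card (S \<inter> {..<b}) + d"
      using d(3) by (simp add: card_Un_disjoint)
    ultimately show ?thesis using d(1) by linarith
  qed
  then show ?thesis
    by (simp add: covers_def compress_def a b eq)
qed

text \<open>The copies of \<open>u\<close> are \<open>2 * u\<close> for Alice and \<open>2 * u + 1\<close> for Bob.\<close>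

definition bipartite_weight :: "int \<Rightarrow> nat weighted_game \<Rightarrow> nat \<Rightarrow> nat \<times> nat \<Rightarrow> int" where
  "bipartite_weight K \<Gamma> s = (\<lambda>(x, y). let u = x div 2; v = y div 2; c = (if even x then - K else K) in
     if even x = (u \<in> alice \<Gamma>)
     then if (u, v) \<in> parcs (arena \<Gamma>) then weight \<Gamma> (u, v) else if v = s then c else 2 * c
     else if v = u then 0 else if v = s then c else 2 * c)"

definition bipartite_game :: "int \<Rightarrow> nat weighted_game \<Rightarrow> nat \<Rightarrow> nat weighted_game" where
  "bipartite_game K \<Gamma> s = (let n = card (pverts (arena \<Gamma>)) in
     \<lparr> arena = \<lparr> pverts = {..<2 * n}, parcs = {(x, y). x < 2 * n \<and> y < 2 * n \<and> even x \<noteq> even y} \<rparr>,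
       alice = {x. x < 2 * n \<and> even x}, bob = {x. x < 2 * n \<and> odd x},
       weight = bipartite_weight K \<Gamma> s \<rparr>)"

lemma bipartite_game_instance:
  assumes "energy_instance (\<Gamma>, s)"
  shows "energy_instance (bipartite_game K \<Gamma> s, 2 * s)" "complete_bipartite_game (bipartite_game K \<Gamma> s)"
proof -
  let ?n = "card (pverts (arena \<Gamma>))"
  obtain n where "pverts (arena \<Gamma>) = {..<n}" "s \<in> pverts (arena \<Gamma>)"
    using assms by (auto simp: energy_instance_def)
  then have s: "s < ?n" by simp
  let ?G = "arena (bipartite_game K \<Gamma> s)"
  have "finite (parcs ?G)"
    by (rule finite_subset[of _ "{..<2 * ?n} \<times> {..<2 * ?n}"]) (auto simp: bipartite_game_def Let_def)
  then have "pair_fin_digraph ?G"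
    by unfold_locales (auto simp: bipartite_game_def Let_def)
  moreover have "\<exists>v. (u, v) \<in> parcs ?G" if "u \<in> pverts ?G" for u
    using that s by (intro exI[of _ "if even u then 1 else 0"]) (auto simp: bipartite_game_def Let_def)
  ultimately show "energy_instance (bipartite_game K \<Gamma> s, 2 * s)"
    using s by (auto simp: energy_instance_def weighted_game_graph_def bipartite_game_def Let_def)
  show "complete_bipartite_game (bipartite_game K \<Gamma> s)"
    by (auto simp: complete_bipartite_game_def bipartite_game_def Let_def)
qed

lemma energy_measure_bipartite_game_iff:
  "energy_measure (bipartite_game K \<Gamma> s) \<phi> \<longleftrightarrow>
     (\<forall>u < card (pverts (arena \<Gamma>)).
       (\<phi> (2 * u) \<noteq> \<infinity> \<longrightarrow>
         (\<exists>v < card (pverts (arena \<Gamma>)). covers (bipartite_weight K \<Gamma> s) \<phi> (2 * u) (2 * v + 1))) \<and>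
       (\<phi> (2 * u + 1) \<noteq> \<infinity> \<longrightarrow>
         (\<forall>v < card (pverts (arena \<Gamma>)). covers (bipartite_weight K \<Gamma> s) \<phi> (2 * u + 1) (2 * v))))"
  (is "?L \<longleftrightarrow> ?R")
proof -
  let ?n = "card (pverts (arena \<Gamma>))"
  have ev: "(\<forall>x. x < 2 * ?n \<and> even x \<longrightarrow> P x) \<longleftrightarrow> (\<forall>u < ?n. P (2 * u))"
    and od: "(\<forall>x. x < 2 * ?n \<and> odd x \<longrightarrow> P x) \<longleftrightarrow> (\<forall>u < ?n. P (2 * u + 1))" for P
    by (auto elim!: evenE oddE)
  have ex: "(\<exists>x. x < 2 * ?n \<and> odd x \<and> P x) \<longleftrightarrow> (\<exists>u < ?n. P (2 * u + 1))" for P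
    using od[of "\<lambda>x. \<not> P x"] by blast
  have "?L \<longleftrightarrow>
     (\<forall>x. x < 2 * ?n \<and> even x \<longrightarrow> \<phi> x \<noteq> \<infinity> \<longrightarrow>
       (\<exists>y. y < 2 * ?n \<and> odd y \<and> covers (bipartite_weight K \<Gamma> s) \<phi> x y)) \<and>
     (\<forall>x. x < 2 * ?n \<and> odd x \<longrightarrow> \<phi> x \<noteq> \<infinity> \<longrightarrow>
       (\<forall>y. y < 2 * ?n \<and> even y \<longrightarrow> covers (bipartite_weight K \<Gamma> s) \<phi> x y))"
    unfolding energy_measure_def bipartite_game_def by (simp add: Let_def)
  also have "\<dots> \<longleftrightarrow> ?R"
    unfolding ev od ex by blast
  finally show ?thesis .
qed

text \<open>There are at most \<open>n * n\<close> arcs, so \<open>n * n * W\<close> bounds what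
  legal moves along a shortest route from home can add to a measure. The additional \<open>W\<close>
  accounts for one further move of Bob.\<close>

locale game_to_bipartite =
  fixes \<Gamma> :: "nat weighted_game" and s n W :: nat and K :: int
  assumes wf: "weighted_game_graph \<Gamma>" and verts: "pverts (arena \<Gamma>) = {..<n}" and s: "s < n"
    and W: "\<And>e. e \<in> parcs (arena \<Gamma>) \<Longrightarrow> \<bar>weight \<Gamma> e\<bar> \<le> int W"
    and K: "int ((n * n + 1) * W) < K"
begin

abbreviation "bw \<equiv> bipartite_weight K \<Gamma> s"

lemma arcs: "(u, v) \<in> parcs (arena \<Gamma>) \<Longrightarrow> u < n \<and> v < n"
  using wf verts unfolding weighted_game_graph_def pair_fin_digraph_def
  by (metis lessThan_iff pair_wf_digraph.in_arcsD1 pair_wf_digraph.in_arcsD2)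

lemma players: "u \<in> bob \<Gamma> \<longleftrightarrow> u < n \<and> u \<notin> alice \<Gamma>" "u \<in> alice \<Gamma> \<Longrightarrow> u < n"
  using wf verts unfolding weighted_game_graph_def by blast+

lemma K_pos: "0 < K"
  using K by (meson of_nat_0_le_iff order_le_less_trans)

lemma n_W_le_K: "int (n * W) \<le> K"
proof -
  have "n * W \<le> (n * n + 1) * W"
    using le_square[of n] by (intro mult_right_mono) linarith+
  then show ?thesis using K by linarith
qed

lemma W_le_K: "int W \<le> K"
proof -
  have "W \<le> (n * n + 1) * W" by simp
  then show ?thesis using K by linarith
qed

lemma less_K:
  assumes "a \<le> c + n * n * W"
  shows "int a + int W < int c + K"
proof -
  have "int a \<le> int c + int (n * n * W)"
    using assms by linarith
  moreover have "int ((n * n + 1) * W) = int (n * n * W) + int W"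
    by (simp add: algebra_simps)
  ultimately show ?thesis using K by linarith
qed

lemma weight_bounds:
  assumes "(u, v) \<in> parcs (arena \<Gamma>)"
  shows "weight \<Gamma> (u, v) \<le> int W" "- int W \<le> weight \<Gamma> (u, v)"
  using W[OF assms] by auto

lemma bw_even: "bw (2 * u, 2 * v + 1) =
    (if u \<in> alice \<Gamma> \<and> (u, v) \<in> parcs (arena \<Gamma>) then weight \<Gamma> (u, v)
     else if u \<notin> alice \<Gamma> \<and> v = u then 0 else if v = s then - K else - 2 * K)"
  by (simp add: bipartite_weight_def Let_def)

lemma bw_odd: "bw (2 * u + 1, 2 * v) =
    (if u \<notin> alice \<Gamma> \<and> (u, v) \<in> parcs (arena \<Gamma>) then weight \<Gamma> (u, v)
     else if u \<in> alice \<Gamma> \<and> v = u then 0 else if v = s then K else 2 * K)"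
  by (simp add: bipartite_weight_def Let_def)

lemma bipartite_measure_of_measure:
  assumes \<phi>: "energy_measure \<Gamma> \<phi>" "\<phi> s \<noteq> \<infinity>"
  shows "\<exists>\<phi>'. energy_measure (bipartite_game K \<Gamma> s) \<phi>' \<and> \<phi>' (2 * s) \<noteq> \<infinity>"
proof -
  \<comment> \<open>Compression makes every finite value, in particular \<open>c\<close>, at most
    \<open>K\<close>.\<close>
  define \<psi> where "\<psi> = compress {..<n} W \<phi>"
  have bound: "int a \<le> K" if "\<psi> u = enat a" for u a
  proof -
    have "a \<le> n * W"
      using compress_le[OF finite_lessThan[of n] that[unfolded \<psi>_def]] by simp
    then show ?thesis using n_W_le_K by linarith
  qed
  have \<psi>_cov: "covers (weight \<Gamma>) \<psi> u v" if "(u, v) \<in> parcs (arena \<Gamma>)" "covers (weight \<Gamma>) \<phi> u v" for u v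
    unfolding \<psi>_def by (rule covers_compress) (use that W arcs in auto)
  have \<psi>_inf: "\<psi> u = \<infinity> \<longleftrightarrow> \<phi> u = \<infinity>" for u
    by (simp add: \<psi>_def compress_eq_infinity_iff)
  obtain c where c: "\<psi> s = enat c"
    using \<phi>(2) \<psi>_inf[of s] by (cases "\<psi> s") auto
  \<comment> \<open>Where \<open>\<psi>\<close> is infinite, Alice's copy gets what she needs for a
    jump home to Bob's copy of \<open>s\<close>, whose value is \<open>c\<close>. Bob's copy gets
    \<open>W\<close> more, since a legal arc may cost her that much before she can jump.\<close>
  define \<phi>' where "\<phi>' x = (if \<psi> (x div 2) \<noteq> \<infinity> then \<psi> (x div 2)
      else if even x then enat (c + nat K) else enat (c + nat K + W))" for x
  have even_le: "\<exists>b. \<phi>' (2 * v) = enat b \<and> int b \<le> int c + K" for v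
    using bound K_pos by (cases "\<psi> v") (fastforce simp: \<phi>'_def)+
  have "\<exists>v<n. covers bw \<phi>' (2 * u) (2 * v + 1)" if "u < n" for u
  proof (cases "\<psi> u")
    case (enat a)
    show ?thesis
    proof (cases "u \<in> alice \<Gamma>")
      case True
      then obtain v where v: "(u, v) \<in> parcs (arena \<Gamma>)" "covers (weight \<Gamma>) \<psi> u v"
        using \<phi>(1) \<psi>_cov \<psi>_inf enat unfolding energy_measure_def by (metis enat.distinct(2))
      then show ?thesis
        using arcs True by (intro exI[of _ v]) (auto simp: covers_def bw_even[simplified] \<phi>'_def)
    next
      case False
      then show ?thesis
        using \<open>u < n\<close> enat by (intro exI[of _ u]) (auto simp: covers_def bw_even[simplified] \<phi>'_def)
    qed
  next
    case infinity
    then have "u \<noteq> s" using c by auto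
    then have "- K \<le> bw (2 * u, 2 * s + 1)"
      using weight_bounds(2)[of u s] W_le_K by (auto simp: bw_even[simplified])
    then show ?thesis
      using s infinity c K_pos by (intro exI[of _ s]) (auto simp: covers_def \<phi>'_def)
  qed
  moreover have "covers bw \<phi>' (2 * u + 1) (2 * v)" if "u < n" "v < n" for u v
  proof (cases "u \<notin> alice \<Gamma> \<and> (u, v) \<in> parcs (arena \<Gamma>) \<and> \<psi> u \<noteq> \<infinity>")
    case True
    then have "u \<in> bob \<Gamma>" "\<phi> u \<noteq> \<infinity>"
      using players \<psi>_inf that by auto
    then have "covers (weight \<Gamma>) \<phi> u v"
      using \<phi>(1) True unfolding energy_measure_def by blast
    then have "covers (weight \<Gamma>) \<psi> u v"
      using \<psi>_cov True by blast
    with True show ?thesis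
      by (auto simp: covers_def bw_odd[simplified] \<phi>'_def)
  next
    case False
    show ?thesis
    proof (cases "u \<in> alice \<Gamma> \<and> v = u")
      case True
      then show ?thesis
        by (cases "\<psi> u") (auto simp: covers_def bw_odd[simplified] \<phi>'_def)
    next
      case no_twin: False
      obtain b where b: "\<phi>' (2 * v) = enat b" "int b \<le> int c + K"
        using even_le by blast
      show ?thesis
      proof (cases "\<psi> u")
        case (enat a)
        then have "bw (2 * u + 1, 2 * v) = (if v = s then K else 2 * K)"
          using False no_twin by (auto simp: bw_odd[simplified])
        \<comment> \<open>A jump home leads to the value \<open>c \<le> K\<close>, any other jump to
          a value of at most \<open>c + K \<le> 2 * K\<close>. So what Bob pays is enough even if
          \<open>a\<close> is 0.\<close>
        moreover have "int b \<le> int a + (if v = s then K else 2 * K)"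
          using b bound[OF c] c by (auto simp: \<phi>'_def)
        ultimately show ?thesis
          using enat b(1) by (auto simp: covers_def \<phi>'_def)
      next
        case infinity
        have "- int W \<le> bw (2 * u + 1, 2 * v)"
          using weight_bounds(2)[of u v] K_pos by (auto simp: bw_odd[simplified])
        then show ?thesis
          using infinity b K_pos by (auto simp: covers_def \<phi>'_def)
      qed
    qed
  qed
  ultimately have "energy_measure (bipartite_game K \<Gamma> s) \<phi>'"
    by (auto simp: energy_measure_bipartite_game_iff verts)
  moreover have "\<phi>' (2 * s) \<noteq> \<infinity>"
    using c by (simp add: \<phi>'_def)
  ultimately show ?thesis by blast
qed

text \<open>Let \<open>c\<close> be the value at the copy of \<open>s\<close> that belongs to its
  owner. By \<open>illegal\<close>, a jump of Alice needs at least \<open>c + K\<close>, while by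
  \<open>reach\<close> legal moves from home lead only to values up to \<open>c + n * n * W\<close>,
  which is too little.\<close>

lemma measure_of_bipartite_measure:
  assumes \<phi>': "energy_measure (bipartite_game K \<Gamma> s) \<phi>'" "\<phi>' (2 * s) \<noteq> \<infinity>"
  shows "\<exists>\<phi>. energy_measure \<Gamma> \<phi> \<and> \<phi> s \<noteq> \<infinity>"
proof -
  have alice: "\<exists>v<n. \<exists>b. \<phi>' (2 * v + 1) = enat b \<and> int b \<le> int a + bw (2 * u, 2 * v + 1)"
    if "u < n" "\<phi>' (2 * u) = enat a" for u a
    using \<phi>'(1) that by (fastforce simp: energy_measure_bipartite_game_iff verts covers_def)
  have bob: "\<exists>b. \<phi>' (2 * v) = enat b \<and> int b \<le> int a + bw (2 * u + 1, 2 * v)"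
    if "u < n" "v < n" "\<phi>' (2 * u + 1) = enat a" for u v a
    using \<phi>'(1) that by (fastforce simp: energy_measure_bipartite_game_iff verts covers_def)
  have jump_home: "bw (2 * u + 1, 2 * s) \<le> K" for u
    using weight_bounds(1)[of u s] W_le_K K_pos by (auto simp: bw_odd[simplified])
  define main where "main u = (if u \<in> alice \<Gamma> then 2 * u else 2 * u + 1)" for u
  obtain a0 where a0: "\<phi>' (2 * s) = enat a0"
    using \<phi>'(2) by auto
  \<comment> \<open>If \<open>s\<close> belongs to Bob, Alice must move from her copy of
    \<open>s\<close> to its twin, at no cost: any other move costs \<open>2 * K\<close>, and Bob
    would return to her copy of \<open>s\<close> for at most \<open>K\<close>.\<close>
  have "\<exists>c. \<phi>' (main s) = enat c \<and> c \<le> a0"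
  proof (cases "s \<in> alice \<Gamma>")
    case True
    then show ?thesis using a0 by (simp add: main_def)
  next
    case False
    obtain v b where v: "v < n" "\<phi>' (2 * v + 1) = enat b" "int b \<le> int a0 + bw (2 * s, 2 * v + 1)"
      using alice[OF s a0] by blast
    have "v = s"
    proof (rule ccontr)
      assume "v \<noteq> s"
      then have "int b \<le> int a0 - 2 * K"
        using v(3) False by (simp add: bw_even[simplified])
      moreover have "int a0 \<le> int b + K"
        using bob[OF v(1) s v(2)] a0 jump_home[of v] by auto
      ultimately show False using K_pos by linarith
    qed
    with v False show ?thesis
      by (simp add: main_def bw_even[simplified])
  qed
  then obtain c where c: "\<phi>' (main s) = enat c" "c \<le> a0" by blast
  \<comment> \<open>A jump home costs \<open>K\<close> and arrives at a value of at least
    \<open>c\<close>. A jump elsewhere costs \<open>2 * K\<close>, and Bob's move home gives back at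
    most \<open>K\<close>.\<close>
  have illegal: "int c + K \<le> int a"
    if "u < n" "v < n" "\<phi>' (2 * u) = enat a" "\<phi>' (2 * v + 1) = enat b"
      and le: "int b \<le> int a + bw (2 * u, 2 * v + 1)"
      and not_legal: "\<not> (u \<in> alice \<Gamma> \<and> (u, v) \<in> parcs (arena \<Gamma>))" "\<not> (u \<notin> alice \<Gamma> \<and> v = u)"
    for u v a b
  proof (cases "v = s")
    case True
    then have "int b + K \<le> int a"
      using le not_legal by (auto simp: bw_even[simplified])
    moreover have "c \<le> b"
    proof (cases "s \<in> alice \<Gamma>")
      case home: True
      then show ?thesis
        using bob[OF s s] that(4) True c(1) by (auto simp: main_def bw_odd[simplified])
    next
      case False
      then show ?thesis
        using that(4) True c(1) by (simp add: main_def)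
    qed
    ultimately show ?thesis by linarith
  next
    case False
    then have "int b + 2 * K \<le> int a"
      using le not_legal by (auto simp: bw_even[simplified])
    moreover have "int a0 \<le> int b + K"
      using bob[OF that(2) s that(4)] a0 jump_home[of v] by auto
    ultimately show ?thesis using c(2) by linarith
  qed
  define r where "r = {(u, v) \<in> parcs (arena \<Gamma>). covers (weight \<Gamma>) (\<phi>' \<circ> main) u v}"
  have r_sub: "r \<subseteq> {..<n} \<times> {..<n}"
    using arcs by (auto simp: r_def)
  then have fin_r: "finite r" and card_r: "card r \<le> n * n"
    using card_mono[OF _ r_sub] by (auto intro: finite_subset)
  have steps: "\<exists>a. \<phi>' (main u) = enat a \<and> a \<le> c + k * W" if "(s, u) \<in> r ^^ k" for u k
    using that
  proof (induction k arbitrary: u)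
    case 0
    then show ?case using c by simp
  next
    case (Suc k)
    then obtain x where x: "(s, x) \<in> r ^^ k" "(x, u) \<in> r" by auto
    from Suc.IH[OF x(1)] x(2) weight_bounds(1)[of x u] show ?case
      by (fastforce simp: r_def covers_def)
  qed
  have reach: "\<exists>a. \<phi>' (main u) = enat a \<and> a \<le> c + n * n * W" if su: "(s, u) \<in> r\<^sup>*" for u
  proof -
    \<comment> \<open>A reachable node is reached in at most \<open>card r\<close> steps, and each
      step raises the value by at most \<open>W\<close>.\<close>
    obtain k where k: "k \<le> card r" "(s, u) \<in> r ^^ k"
      using su unfolding rtrancl_finite_eq_relpow[OF fin_r] by blast
    have "k * W \<le> n * n * W"
      using k(1) card_r by (intro mult_right_mono) auto
    moreover obtain a where "\<phi>' (main u) = enat a" "a \<le> c + k * W"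
      using steps[OF k(2)] by blast
    ultimately show ?thesis by (intro exI[of _ a]) linarith
  qed
  \<comment> \<open>At nodes that \<open>r\<close> does not reach from \<open>s\<close>, Alice may
    depend on jumps, so they get the value \<infinity>.\<close>
  define \<phi> where "\<phi> u = (if (s, u) \<in> r\<^sup>* then \<phi>' (main u) else \<infinity>)" for u
  have cov: "covers (weight \<Gamma>) \<phi> u v"
    if "(s, u) \<in> r\<^sup>*" "(u, v) \<in> parcs (arena \<Gamma>)" "covers (weight \<Gamma>) (\<phi>' \<circ> main) u v" for u v
  proof -
    have "(s, v) \<in> r\<^sup>*"
      using that by (auto simp: r_def intro: rtrancl_into_rtrancl)
    then show ?thesis using that by (auto simp: \<phi>_def covers_def)
  qed
  have "energy_measure \<Gamma> \<phi>"
    unfolding energy_measure_def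
  proof (intro conjI ballI impI allI)
    fix u assume u: "u \<in> alice \<Gamma>" "\<phi> u \<noteq> \<infinity>"
    then have su: "(s, u) \<in> r\<^sup>*"
      by (auto simp: \<phi>_def split: if_splits)
    then obtain a where a: "\<phi>' (2 * u) = enat a" "a \<le> c + n * n * W"
      using reach u(1) unfolding main_def by metis
    obtain v b where v: "v < n" "\<phi>' (2 * v + 1) = enat b" "int b \<le> int a + bw (2 * u, 2 * v + 1)"
      using alice[OF _ a(1)] players u(1) by blast
    have "int a < int c + K"
      using less_K[OF a(2)] by simp
    then have arc: "(u, v) \<in> parcs (arena \<Gamma>)"
      using illegal[OF _ v(1) a(1) v(2,3)] players u(1) by force
    have le: "int b \<le> int a + weight \<Gamma> (u, v)"
      using v(3) arc u(1) by (simp add: bw_even[simplified])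
    \<comment> \<open>The arc leads to Bob's copy of \<open>v\<close>. If \<open>v\<close> belongs
      to Alice, the twin move of weight 0 shows that her copy needs no more energy.\<close>
    have "covers (weight \<Gamma>) (\<phi>' \<circ> main) u v"
    proof (cases "v \<in> alice \<Gamma>")
      case True
      then obtain b' where "\<phi>' (2 * v) = enat b'" "b' \<le> b"
        using bob[OF v(1) v(1) v(2)] by (auto simp: bw_odd[simplified])
      then show ?thesis
        using True u(1) a(1) le by (simp add: covers_def main_def)
    next
      case False
      then show ?thesis
        using v(2) u(1) a(1) le by (simp add: covers_def main_def)
    qed
    with su arc show "\<exists>v. (u, v) \<in> parcs (arena \<Gamma>) \<and> covers (weight \<Gamma>) \<phi> u v"
      using cov by blast
  next
    fix u v assume u: "u \<in> bob \<Gamma>" "\<phi> u \<noteq> \<infinity>" and arc: "(u, v) \<in> parcs (arena \<Gamma>)"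
    then have su: "(s, u) \<in> r\<^sup>*" and ua: "u \<notin> alice \<Gamma>" "u < n" "v < n"
      using players arcs by (auto simp: \<phi>_def split: if_splits)
    then obtain a where a: "\<phi>' (2 * u + 1) = enat a" "a \<le> c + n * n * W"
      using reach unfolding main_def by metis
    obtain b where b: "\<phi>' (2 * v) = enat b" "int b \<le> int a + weight \<Gamma> (u, v)"
      using bob[OF ua(2,3) a(1)] ua arc by (auto simp: bw_odd[simplified])
    have "covers (weight \<Gamma>) (\<phi>' \<circ> main) u v"
    proof (cases "v \<in> alice \<Gamma>")
      case True
      then show ?thesis
        using ua a(1) b by (simp add: covers_def main_def)
    next
      case False
      obtain v' b' where v': "v' < n" "\<phi>' (2 * v' + 1) = enat b'"
          "int b' \<le> int b + bw (2 * v, 2 * v' + 1)"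
        using alice[OF ua(3) b(1)] by blast
      \<comment> \<open>Bob's move led to Alice's copy of his own node \<open>v\<close>. Even after
        this move she cannot afford a jump, so she must move to the twin; this is where the
        additional \<open>W\<close> in the bound on \<open>K\<close> is spent.\<close>
      have "int b < int c + K"
        using less_K[OF a(2)] b(2) weight_bounds(1)[OF arc] by simp
      then have "v' = v"
        using illegal[OF ua(3) v'(1) b(1) v'(2,3)] False by force
      then show ?thesis
        using v' False ua a(1) b(2) by (simp add: covers_def main_def bw_even[simplified])
    qed
    with su arc show "covers (weight \<Gamma>) \<phi> u v"
      using cov by blast
  qed
  moreover have "\<phi> s \<noteq> \<infinity>"
    using c by (simp add: \<phi>_def)
  ultimately show ?thesis by blast
qed

lemma minimal_energy_bipartite_game:
  "minimal_energy (bipartite_game K \<Gamma> s) (2 * s) < \<infinity> \<longleftrightarrow> minimal_energy \<Gamma> s < \<infinity>"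
proof -
  have "energy_instance (\<Gamma>, s)"
    using wf verts s by (auto simp: energy_instance_def)
  from bipartite_game_instance(1)[OF this, of K]
  have "weighted_game_graph (bipartite_game K \<Gamma> s)" "2 * s \<in> pverts (arena (bipartite_game K \<Gamma> s))"
    by (auto simp: energy_instance_def)
  moreover have "s \<in> pverts (arena \<Gamma>)"
    using s verts by simp
  ultimately show ?thesis
    using bipartite_measure_of_measure measure_of_bipartite_measure
    by (auto simp: minimal_energy_finite_iff wf simp del: enat_ord_simps)
qed

end


section \<open>While programs over tapes\<close>

datatype program =
    Op nat "symbol \<Rightarrow> symbol \<times> move"
  | Seq program program
  | While nat "symbol \<Rightarrow> bool" program
  | If nat "symbol \<Rightarrow> bool" program program

text \<open>The number is the exact number of steps of the compiled machine: tests and operations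
  take one step each, sequencing takes none.\<close>

inductive exec :: "program \<Rightarrow> tape list \<Rightarrow> nat \<Rightarrow> tape list \<Rightarrow> bool" where
  Op: "i < length ts \<Longrightarrow> exec (Op i a) ts 1 (ts[i := act (a ((ts ! i) 0)) (ts ! i)])"
| Seq: "exec p ts t ts' \<Longrightarrow> exec q ts' t' ts'' \<Longrightarrow> exec (Seq p q) ts (t + t') ts''"
| While_False: "i < length ts \<Longrightarrow> \<not> b ((ts ! i) 0) \<Longrightarrow> exec (While i b p) ts 1 ts"
| While_True: "i < length ts \<Longrightarrow> b ((ts ! i) 0) \<Longrightarrow> exec p ts t ts' \<Longrightarrow>
    exec (While i b p) ts' t' ts'' \<Longrightarrow> exec (While i b p) ts (Suc (t + t')) ts''"
| If_True: "i < length ts \<Longrightarrow> b ((ts ! i) 0) \<Longrightarrow> exec p ts t ts' \<Longrightarrow>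
    exec (If i b p q) ts (Suc t) ts'"
| If_False: "i < length ts \<Longrightarrow> \<not> b ((ts ! i) 0) \<Longrightarrow> exec q ts t ts' \<Longrightarrow>
    exec (If i b p q) ts (Suc t) ts'"

lemma exec_length: "exec p ts t ts' \<Longrightarrow> length ts' = length ts"
  by (induction rule: exec.induct) auto

primrec states :: "program \<Rightarrow> nat" where
  "states (Op i a) = 1"
| "states (Seq p q) = states p + states q"
| "states (While i b p) = Suc (states p)"
| "states (If i b p q) = Suc (states p + states q)"

definition stay :: "symbol list \<Rightarrow> (symbol \<times> move) list" where
  "stay ss = map (\<lambda>a. (a, No_Move)) ss"

text \<open>
  \<open>code p m e\<close> is the transition function of \<open>p\<close>, which occupies the states from \<open>m\<close> on
  and is left through state \<open>e\<close>.
\<close>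

primrec code :: "program \<Rightarrow> nat \<Rightarrow> nat \<Rightarrow> nat \<Rightarrow> symbol list \<Rightarrow> nat \<times> (symbol \<times> move) list" where
  "code (Op i a) m e q ss = (e, (stay ss)[i := a (ss ! i)])"
| "code (Seq p p') m e q ss =
     (if q < m + states p then code p m (m + states p) q ss else code p' (m + states p) e q ss)"
| "code (While i b p) m e q ss =
     (if q = m then (if b (ss ! i) then Suc m else e, stay ss) else code p (Suc m) m q ss)"
| "code (If i b p p') m e q ss =
     (if q = m then (if b (ss ! i) then Suc m else Suc m + states p, stay ss)
      else if q < Suc m + states p then code p (Suc m) e q ss
      else code p' (Suc m + states p) e q ss)"

lemma length_stay [simp]: "length (stay ss) = length ss"
  by (simp add: stay_def)

lemma length_code:
  "m \<le> q \<Longrightarrow> q < m + states p \<Longrightarrow> length (snd (code p m e q ss)) = length ss"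
  by (induction p arbitrary: m e) auto

lemma act_No_Move [simp]: "act (t 0, No_Move) t = t"
  by (simp add: act_def)

lemma map2_act_stay:
  "map2 act (stay (map (\<lambda>t. t 0) ts)) ts = ts"
  by (induction ts) (auto simp: stay_def)

lemma map2_act_update:
  "i < length ts \<Longrightarrow> map2 act ((stay (map (\<lambda>t. t 0) ts))[i := a]) ts = ts[i := act a (ts ! i)]"
proof (induction ts arbitrary: i)
  case Nil
  then show ?case by simp
next
  case (Cons t ts)
  then show ?case
    using map2_act_stay[of ts] by (cases i) (auto simp: stay_def)
qed

lemma step_unfold:
  assumes "q < state_count M" "transition M q (map (\<lambda>t. t 0) ts) = (q', as)"
  shows "step M (q, ts) = (q', map2 act as ts)"
  using assms by (simp add: step_def)

text \<open>The machine has to agree with \<open>code p m e\<close> on the states of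
  \<open>p\<close> only, so that the induction applies to subprograms inside a larger
  machine.\<close>

lemma exec_steps:
  assumes "exec p ts t ts'"
    and "length ts = tape_count M" "m + states p \<le> state_count M"
    and "\<And>q ss. m \<le> q \<Longrightarrow> q < m + states p \<Longrightarrow> length ss = tape_count M \<Longrightarrow>
      transition M q ss = code p m e q ss"
  shows "(step M ^^ t) (m, ts) = (e, ts')"
  using assms
proof (induction arbitrary: m e rule: exec.induct)
  case (Op i ts a)
  then show ?case
    by (simp add: step_unfold map2_act_update)
next
  case (Seq p ts t ts' q t' ts'')
  have "(step M ^^ t) (m, ts) = (m + states p, ts')"
    using Seq.prems by (intro Seq.IH(1)) auto
  moreover have "(step M ^^ t') (m + states p, ts') = (e, ts'')"
    using Seq.prems exec_length[OF Seq.hyps(1)] by (intro Seq.IH(2)) auto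
  ultimately show ?case
    by (simp add: add.commute[of t] funpow_add)
next
  case (While_False i ts b p)
  then show ?case
    by (simp add: step_unfold map2_act_stay)
next
  case (While_True i ts b p t ts' t' ts'')
  have "step M (m, ts) = (Suc m, ts)"
    using While_True.hyps While_True.prems by (simp add: step_unfold map2_act_stay)
  moreover have "(step M ^^ t) (Suc m, ts) = (m, ts')"
    using While_True.prems by (intro While_True.IH(1)) auto
  moreover have "(step M ^^ t') (m, ts') = (e, ts'')"
    using While_True.prems exec_length[OF While_True.hyps(3)] by (intro While_True.IH(2)) auto
  ultimately show ?case
    by (simp add: add.commute[of t] funpow_add funpow_swap1)
next
  case (If_True i ts b p t ts' q)
  have "step M (m, ts) = (Suc m, ts)"
    using If_True.hyps If_True.prems by (simp add: step_unfold map2_act_stay)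
  moreover have "(step M ^^ t) (Suc m, ts) = (e, ts')"
    using If_True.prems by (intro If_True.IH) auto
  ultimately show ?case
    by (simp add: funpow_swap1)
next
  case (If_False i ts b q t ts' p)
  have "step M (m, ts) = (Suc m + states p, ts)"
    using If_False.hyps If_False.prems by (simp add: step_unfold map2_act_stay)
  moreover have "(step M ^^ t) (Suc m + states p, ts) = (e, ts')"
    using If_False.prems by (intro If_False.IH) auto
  ultimately show ?case
    by (simp add: funpow_swap1)
qed

text \<open>The exit state \<open>states p\<close> is the first number that is not a state, so
  leaving the program means halting.\<close>

definition compile :: "nat \<Rightarrow> program \<Rightarrow> turing_machine" where
  "compile k p = \<lparr> tape_count = k, state_count = states p, transition = code p 0 (states p) \<rparr>"

definition runs :: "program \<Rightarrow> tape list \<Rightarrow> nat \<Rightarrow> tape list \<Rightarrow> bool" where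
  "runs p ts T ts' \<longleftrightarrow> (\<exists>t \<le> T. exec p ts t ts')"

lemma polytime_computableI:
  fixes P :: "nat poly"
  assumes "\<And>x. \<exists>R. runs p (word_tape x # replicate k (word_tape [])) (poly P (length x))
    (word_tape (f x) # R)"
  shows "polytime_computable f"
proof -
  let ?M = "compile (Suc k) p"
  have "turing_machine ?M"
    by (auto simp: turing_machine_def compile_def length_code)
  moreover have "\<exists>t \<le> poly P (length x). halts_with ?M x t (f x)" for x
  proof -
    obtain R t where t: "t \<le> poly P (length x)"
      and exec: "exec p (word_tape x # replicate k (word_tape [])) t (word_tape (f x) # R)"
      using assms unfolding runs_def by blast
    have "(step ?M ^^ t) (0, word_tape x # replicate k (word_tape [])) =
        (states p, word_tape (f x) # R)"
      by (rule exec_steps[OF exec]) (auto simp: compile_def)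
    then have "halts_with ?M x t (f x)"
      by (simp add: halts_with_def start_config_def compile_def)
    with t show ?thesis
      by blast
  qed
  ultimately show ?thesis
    unfolding polytime_computable_def by blast
qed

lemma runs_weaken: "runs p ts T ts' \<Longrightarrow> T \<le> T' \<Longrightarrow> runs p ts T' ts'"
  unfolding runs_def by (meson order_trans)

lemma runs_Op: "i < length ts \<Longrightarrow> ts' = ts[i := act (a ((ts ! i) 0)) (ts ! i)] \<Longrightarrow> runs (Op i a) ts 1 ts'"
  unfolding runs_def using exec.Op by blast

lemma runs_Seq: "runs p ts T ts' \<Longrightarrow> runs q ts' T' ts'' \<Longrightarrow> runs (Seq p q) ts (T + T') ts''"
  unfolding runs_def by (meson add_mono exec.Seq)

lemma runs_If:
  assumes "i < length ts"
    and "b ((ts ! i) 0) \<Longrightarrow> runs p ts T ts'" "\<not> b ((ts ! i) 0) \<Longrightarrow> runs q ts T ts'"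
  shows "runs (If i b p q) ts (Suc T) ts'"
  using assms exec.If_True exec.If_False unfolding runs_def by (metis Suc_le_mono)

lemma runs_While_False: "i < length ts \<Longrightarrow> \<not> b ((ts ! i) 0) \<Longrightarrow> runs (While i b p) ts 1 ts"
  unfolding runs_def using exec.While_False by blast

lemma runs_While_True:
  assumes "i < length ts" "b ((ts ! i) 0)" "runs p ts T ts'" "runs (While i b p) ts' T' ts''"
  shows "runs (While i b p) ts (Suc (T + T')) ts''"
  using assms exec.While_True unfolding runs_def by (metis Suc_le_mono add_mono)

lemma runs_While_iterate:
  assumes len: "\<And>j. j \<le> n \<Longrightarrow> i < length (S j)"
    and body: "\<And>j. j < n \<Longrightarrow> b ((S j ! i) 0) \<and> runs p (S j) T (S (Suc j))"
    and exit: "\<not> b ((S n ! i) 0)"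
  shows "runs (While i b p) (S 0) (n * Suc T + 1) (S n)"
proof -
  have "runs (While i b p) (S (n - j)) (j * Suc T + 1) (S n)" if "j \<le> n" for j
    using that
  proof (induction j)
    case 0
    then show ?case
      using len[of n] exit runs_While_False[of i "S n" b p] by simp
  next
    case (Suc j)
    then have "n - Suc j < n" "Suc (n - Suc j) = n - j" by auto
    then have "b ((S (n - Suc j) ! i) 0)" "runs p (S (n - Suc j)) T (S (n - j))"
      using body[of "n - Suc j"] by auto
    moreover have "runs (While i b p) (S (n - j)) (j * Suc T + 1) (S n)"
      using Suc by simp
    ultimately have "runs (While i b p) (S (n - Suc j)) (Suc (T + (j * Suc T + 1))) (S n)"
      using len[of "n - Suc j"] by (intro runs_While_True) auto
    then show ?case by (simp add: algebra_simps)
  qed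
  from this[of n] show ?thesis by simp
qed


section \<open>A program for the reduction\<close>

definition shift :: "int \<Rightarrow> tape \<Rightarrow> tape" where
  "shift k t = (\<lambda>i. t (i + k))"

text \<open>A number in unary. Since a head movement merely translates both ends, they also record
  where the head stands.\<close>

definition seg :: "int \<Rightarrow> int \<Rightarrow> tape" where
  "seg a b = (\<lambda>i. if a \<le> i \<and> i < b then Some True else None)"

definition mark :: "int \<Rightarrow> tape" where
  "mark k = (\<lambda>i. if i = k then Some True else None)"

definition written :: "bool list \<Rightarrow> tape" where
  "written ys = shift (int (length ys)) (word_tape ys)"

text \<open>The machine's test for the symbol 1 also fails on a blank, so exhausted input reads as
  \<open>False\<close>.\<close>

definition rd :: "bool list \<Rightarrow> bool" where
  "rd xs \<longleftrightarrow> (case xs of [] \<Rightarrow> False | x # _ \<Rightarrow> x)"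

lemma rd_simps [simp]: "\<not> rd []" "rd (x # xs) = x"
  by (simp_all add: rd_def)

lemma act_keep: "act (t 0, m) t = shift (offset m) t"
  by (simp add: act_def shift_def)

lemma shift_shift [simp]: "shift k (shift l t) = shift (k + l) t"
  by (simp add: shift_def add.assoc)

lemma shift_0 [simp]: "shift 0 t = t"
  by (simp add: shift_def)

lemma shift_seg [simp]: "shift k (seg a b) = seg (a - k) (b - k)"
  by (auto simp: shift_def seg_def fun_eq_iff)

lemma shift_mark [simp]: "shift k (mark a) = mark (a - k)"
  by (auto simp: shift_def mark_def fun_eq_iff)

lemma seg_head: "seg a b 0 = (if a \<le> 0 \<and> 0 < b then Some True else None)"
  by (simp add: seg_def)

lemma mark_head: "mark k 0 = (if k = 0 then Some True else None)"
  by (simp add: mark_def)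

lemma word_tape_head: "word_tape xs 0 = (case xs of [] \<Rightarrow> None | x # _ \<Rightarrow> Some x)"
  by (cases xs) (auto simp: word_tape_def)

lemma shift_word_tape_head:
  "shift k (word_tape xs) 0 = (if 0 \<le> k \<and> k < int (length xs) then Some (xs ! nat k) else None)"
  by (simp add: shift_def word_tape_def)

lemma word_tape_Nil_seg: "word_tape [] = seg 1 1"
  by (auto simp: word_tape_def seg_def fun_eq_iff)

lemma word_tape_Nil_shift: "shift k (word_tape []) = word_tape []"
  by (auto simp: word_tape_def shift_def fun_eq_iff)

lemma act_consume: "act (None, Move_Right) (word_tape xs) = word_tape (tl xs)"
proof
  fix i
  show "act (None, Move_Right) (word_tape xs) i = word_tape (tl xs) i"
    by (cases xs; cases "i = -1") (auto simp: act_def word_tape_def nth_Cons' nat_diff_distrib nat_add_distrib)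
qed

lemma act_emit: "act (Some b, Move_Right) (written ys) = written (ys @ [b])"
proof
  fix i
  show "act (Some b, Move_Right) (written ys) i = written (ys @ [b]) i"
    by (auto simp: act_def word_tape_def written_def shift_def nth_append nat_less_iff algebra_simps)
qed

lemma act_push: "1 \<le> b \<Longrightarrow> act (Some True, Move_Left) (seg 1 b) = seg 1 (b + 1)"
  by (auto simp: act_def seg_def fun_eq_iff)

lemma act_mark: "act (Some True, No_Move) (word_tape []) = mark 0"
  by (auto simp: act_def word_tape_def mark_def fun_eq_iff)

lemma act_prepend:
  "act (Some b, Move_Left) (shift (-1) (word_tape zs)) = shift (-1) (word_tape (b # zs))"
proof
  fix i
  show "act (Some b, Move_Left) (shift (-1) (word_tape zs)) i = shift (-1) (word_tape (b # zs)) i"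
    by (auto simp: act_def shift_def word_tape_def nth_Cons' nat_diff_distrib numeral_2_eq_2)
qed

definition is_True :: "symbol \<Rightarrow> bool" where
  "is_True a \<longleftrightarrow> a = Some True"

definition nonblank :: "symbol \<Rightarrow> bool" where
  "nonblank a \<longleftrightarrow> a \<noteq> None"

text \<open>
  Tape 0 holds the unread input and finally the output, tape 1 is the output under construction,
  tape 2 holds the number of nodes and tape 5 the length of the input in unary, and tapes 3 and 4
  mark the home node and the current row.
\<close>

definition emit :: "bool \<Rightarrow> program" where
  "emit b = Op 1 (\<lambda>_. (Some b, Move_Right))"

definition consume :: program where
  "consume = Op 0 (\<lambda>_. (None, Move_Right))"

definition move_head :: "nat \<Rightarrow> move \<Rightarrow> program" where
  "move_head i m = Op i (\<lambda>a. (a, m))"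

lemma runs_move_head:
  "i < length ts \<Longrightarrow> ts' = ts[i := shift (offset m) (ts ! i)] \<Longrightarrow> runs (move_head i m) ts 1 ts'"
  unfolding move_head_def by (rule runs_Op) (simp_all add: act_keep)

text \<open>The rewinding loop must start on the block and stops on the blank before it, whence the
  single steps on either side. \<open>mv\<close> is a parameter because \<open>columns\<close> moves
  several heads together.\<close>

definition scan :: "nat \<Rightarrow> (move \<Rightarrow> program) \<Rightarrow> program \<Rightarrow> program" where
  "scan i mv p = Seq (While i nonblank (Seq p (mv Move_Right)))
     (Seq (mv Move_Left) (Seq (While i nonblank (mv Move_Left)) (mv Move_Right)))"

text \<open>\<open>F\<close> and \<open>F'\<close> are the configurations before and after
  \<open>p\<close> at cell \<open>j\<close>. On the way back only heads move; \<open>G\<close> takes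
  an integer because the head passes position -1.\<close>

lemma runs_scan:
  assumes fwd: "\<And>j. j < n \<Longrightarrow> runs p (F j) T (F' j) \<and> runs (mv Move_Right) (F' j) C (F (Suc j))"
    and mv: "\<And>k m. runs (mv m) (G k) C (G (k + offset m))"
    and F: "\<And>j. j \<le> n \<Longrightarrow> i < length (F j) \<and> (nonblank ((F j ! i) 0) \<longleftrightarrow> j < n)"
    and G: "\<And>k. i < length (G k) \<and> (nonblank ((G k ! i) 0) \<longleftrightarrow> 0 \<le> k \<and> k < int n)"
    and FG: "F n = G (int n)"
  shows "runs (scan i mv p) (F 0) (n * (T + 2 * C + 2) + 2 * C + 2) (G 0)"
proof -
  have "runs (While i nonblank (Seq p (mv Move_Right))) (F 0) (n * Suc (T + C) + 1) (F n)"
    by (rule runs_While_iterate) (use fwd F in \<open>auto intro: runs_Seq\<close>)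
  moreover have "runs (mv Move_Left) (F n) C (G (int n - 1))"
    using mv[of Move_Left "int n"] by (simp add: FG)
  moreover have "runs (While i nonblank (mv Move_Left)) (G (int n - 1 - int 0)) (n * Suc C + 1)
      (G (int n - 1 - int n))"
  proof (rule runs_While_iterate[where S = "\<lambda>j. G (int n - 1 - int j)"])
    fix j assume "j < n"
    then show "nonblank ((G (int n - 1 - int j) ! i) 0) \<and>
        runs (mv Move_Left) (G (int n - 1 - int j)) C (G (int n - 1 - int (Suc j)))"
      using mv[of Move_Left "int n - 1 - int j"] G by (simp add: algebra_simps)
  qed (use G in auto)
  moreover have "runs (mv Move_Right) (G (- 1)) C (G 0)"
    using mv[of Move_Right "-1"] by simp
  ultimately have "runs (scan i mv p) (F 0)
      ((n * Suc (T + C) + 1) + (C + ((n * Suc C + 1) + C))) (G 0)"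
    unfolding scan_def by (intro runs_Seq) auto
  then show ?thesis
    by (rule runs_weaken) (simp add: algebra_simps)
qed

section \<open>Functional models of the programs\<close>

type_synonym transducer = "bool list \<Rightarrow> bool list \<times> bool list"

definition outputs :: "bool list \<Rightarrow> transducer" where
  "outputs ys = (\<lambda>xs. (ys, xs))"

definition skips :: transducer where
  "skips = (\<lambda>xs. ([], tl xs))"

definition seq_td :: "transducer \<Rightarrow> transducer \<Rightarrow> transducer" (infixr ";;" 60) where
  "g ;; h = (\<lambda>xs. (fst (g xs) @ fst (h (snd (g xs))), snd (h (snd (g xs)))))"

definition branch :: "transducer \<Rightarrow> transducer \<Rightarrow> transducer" where
  "branch g h = (\<lambda>xs. if rd xs then g xs else h xs)"

abbreviation st :: "bool list \<Rightarrow> bool list \<Rightarrow> tape list \<Rightarrow> tape list" where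
  "st xs ys R \<equiv> word_tape xs # written ys # R"

text \<open>A transducer returns the bits emitted and the unread input. The unread input never
  grows, so the bound \<open>M\<close> survives sequencing. \<open>T\<close> also bounds the output,
  which \<open>copy_back\<close> has to traverse later, and the auxiliary tapes \<open>R\<close> are
  restored.\<close>

definition implements :: "tape list \<Rightarrow> nat \<Rightarrow> nat \<Rightarrow> program \<Rightarrow> transducer \<Rightarrow> bool" where
  "implements R M T p g \<longleftrightarrow> (\<forall>xs ys. length xs \<le> M \<longrightarrow>
     length (snd (g xs)) \<le> length xs \<and> length (fst (g xs)) \<le> T \<and>
     runs p (st xs ys R) T (st (snd (g xs)) (ys @ fst (g xs)) R))"

lemma implementsD:
  assumes "implements R M T p g" "length xs \<le> M"
  shows "length (snd (g xs)) \<le> length xs" "length (fst (g xs)) \<le> T"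
    "runs p (st xs ys R) T (st (snd (g xs)) (ys @ fst (g xs)) R)"
  using assms unfolding implements_def by blast+

lemma implements_weaken: "implements R M T p g \<Longrightarrow> T \<le> T' \<Longrightarrow> implements R M T' p g"
  unfolding implements_def by (meson order_trans runs_weaken)

lemma implements_emit: "implements R M 1 (emit b) (outputs [b])"
  unfolding implements_def emit_def
  by (auto simp: outputs_def act_emit intro!: runs_Op[of 1, simplified])

lemma implements_consume: "implements R M 1 consume skips"
  unfolding implements_def consume_def
  by (auto simp: skips_def act_consume intro!: runs_Op[of 0, simplified])

lemma implements_Seq:
  assumes p: "implements R M T p g" and q: "implements R M T' q h"
  shows "implements R M (T + T') (Seq p q) (g ;; h)"
  unfolding implements_def
proof (intro allI impI)
  fix xs ys :: "bool list" assume xs: "length xs \<le> M"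
  note 1 = implementsD[OF p xs]
  have "length (snd (g xs)) \<le> M" using 1(1) xs by simp
  note 2 = implementsD[OF q this]
  show "length (snd ((g ;; h) xs)) \<le> length xs \<and> length (fst ((g ;; h) xs)) \<le> T + T' \<and>
      runs (Seq p q) (st xs ys R) (T + T') (st (snd ((g ;; h) xs)) (ys @ fst ((g ;; h) xs)) R)"
    using 1(1,2) 2(1,2) runs_Seq[OF 1(3) 2(3)] by (auto simp: seq_td_def)
qed

lemma implements_branch:
  assumes "implements R M T p g" "implements R M T q h"
  shows "implements R M (Suc T) (If 0 is_True p q) (branch g h)"
  unfolding implements_def
proof (intro allI impI)
  fix xs ys :: "bool list" assume xs: "length xs \<le> M"
  have head: "is_True ((st xs ys R ! 0) 0) \<longleftrightarrow> rd xs"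
    by (cases xs) (auto simp: is_True_def word_tape_head)
  have "runs (If 0 is_True p q) (st xs ys R) (Suc T)
      (st (snd (branch g h xs)) (ys @ fst (branch g h xs)) R)"
    by (rule runs_If) (use head implementsD(3)[OF assms(1) xs] implementsD(3)[OF assms(2) xs] in
        \<open>auto simp: branch_def\<close>)
  then show "length (snd (branch g h xs)) \<le> length xs \<and> length (fst (branch g h xs)) \<le> Suc T \<and>
      runs (If 0 is_True p q) (st xs ys R) (Suc T)
        (st (snd (branch g h xs)) (ys @ fst (branch g h xs)) R)"
    using implementsD(1,2)[OF assms(1) xs] implementsD(1,2)[OF assms(2) xs]
    by (auto simp: branch_def)
qed

lemma implements_If:
  assumes "i < length R"
    and "implements R M T p g" "implements R M T q h"
  shows "implements R M (Suc T) (If (i + 2) is_True p q) (if is_True ((R ! i) 0) then g else h)"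
  unfolding implements_def
proof (intro allI impI)
  fix xs ys :: "bool list" assume xs: "length xs \<le> M"
  let ?g = "if is_True ((R ! i) 0) then g else h"
  have "runs (If (i + 2) is_True p q) (st xs ys R) (Suc T) (st (snd (?g xs)) (ys @ fst (?g xs)) R)"
    by (rule runs_If) (use assms(1) implementsD(3)[OF assms(2) xs] implementsD(3)[OF assms(3) xs] in
        \<open>auto\<close>)
  then show "length (snd (?g xs)) \<le> length xs \<and> length (fst (?g xs)) \<le> Suc T \<and>
      runs (If (i + 2) is_True p q) (st xs ys R) (Suc T) (st (snd (?g xs)) (ys @ fst (?g xs)) R)"
    using implementsD(1,2)[OF assms(2) xs] implementsD(1,2)[OF assms(3) xs] by auto
qed

primrec emits :: "bool \<Rightarrow> bool list \<Rightarrow> program" where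
  "emits b [] = emit b"
| "emits b (c # cs) = Seq (emit b) (emits c cs)"

lemma implements_emits: "implements R M (Suc (length cs)) (emits b cs) (outputs (b # cs))"
proof (induction cs arbitrary: b)
  case Nil
  then show ?case using implements_emit by simp
next
  case (Cons c cs)
  have "outputs (b # c # cs) = outputs [b] ;; outputs (c # cs)"
    by (simp add: outputs_def seq_td_def)
  then show ?case
    using implements_Seq[OF implements_emit[of R M b] Cons.IH[of c]] by simp
qed

section \<open>Copying legal entries and writing jumps\<close>

definition copy_bit :: program where
  "copy_bit = If 0 is_True (Seq consume (emit True)) (Seq consume (emit False))"

definition copy_bit_td :: transducer where
  "copy_bit_td = (\<lambda>xs. ([rd xs], tl xs))"

lemma implements_copy_bit: "implements R M 3 copy_bit copy_bit_td"
proof -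
  have "implements R M (Suc (1 + 1)) copy_bit
      (branch (skips ;; outputs [True]) (skips ;; outputs [False]))"
    unfolding copy_bit_def
    by (intro implements_branch implements_Seq implements_consume implements_emit)
  moreover have "branch (skips ;; outputs [True]) (skips ;; outputs [False]) = copy_bit_td"
    by (auto simp: branch_def skips_def outputs_def seq_td_def copy_bit_td_def)
  ultimately show ?thesis by (simp add: eval_nat_numeral)
qed

text \<open>Copies the pairs of continuation bit and value bit of \<open>encode_nat\<close> and
  stops before the final \<open>False\<close>. The use of \<open>rd\<close> and \<open>tl\<close>
  gives it a meaning on truncated words too.\<close>

fun copy_pairs_td :: transducer where
  "copy_pairs_td (True # xs) =
     (True # rd xs # fst (copy_pairs_td (tl xs)), snd (copy_pairs_td (tl xs)))"
| "copy_pairs_td xs = ([], xs)"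

definition copy_pairs :: program where
  "copy_pairs = While 0 is_True (Seq consume (Seq (emit True) copy_bit))"

lemma implements_copy_pairs: "implements R M (6 * M + 1) copy_pairs copy_pairs_td"
proof -
  have step: "implements R M' (1 + (1 + 3)) (Seq consume (Seq (emit True) copy_bit))
      (skips ;; outputs [True] ;; copy_bit_td)" for M'
    by (intro implements_Seq implements_consume implements_emit implements_copy_bit)
  have *: "length (snd (copy_pairs_td xs)) \<le> length xs \<and>
      length (fst (copy_pairs_td xs)) \<le> 6 * length xs + 1 \<and>
      runs copy_pairs (st xs ys R) (6 * length xs + 1)
        (st (snd (copy_pairs_td xs)) (ys @ fst (copy_pairs_td xs)) R)" for xs ys
  proof (induction xs arbitrary: ys rule: copy_pairs_td.induct)
    case (1 xs)
    let ?ys = "ys @ [True, rd xs]"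
    note IH = 1[of ?ys]
    have "runs (Seq consume (Seq (emit True) copy_bit)) (st (True # xs) ys R) 5 (st (tl xs) ?ys R)"
      using implementsD(3)[OF step order_refl, of "True # xs" ys]
      by (simp add: seq_td_def skips_def outputs_def copy_bit_td_def)
    then have "runs copy_pairs (st (True # xs) ys R) (Suc (5 + (6 * length (tl xs) + 1)))
        (st (snd (copy_pairs_td (tl xs))) (?ys @ fst (copy_pairs_td (tl xs))) R)"
      unfolding copy_pairs_def
      by (rule runs_While_True[rotated 2])
        (use IH in \<open>auto simp: is_True_def word_tape_head copy_pairs_def\<close>)
    then have "runs copy_pairs (st (True # xs) ys R) (6 * length (True # xs) + 1)
        (st (snd (copy_pairs_td (tl xs))) (?ys @ fst (copy_pairs_td (tl xs))) R)"
      by (rule runs_weaken) simp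
    then show ?case using IH by auto
  qed (auto simp: copy_pairs_def is_True_def word_tape_head
      intro: runs_weaken[OF runs_While_False])
  show ?thesis
    unfolding implements_def
  proof (intro allI impI)
    fix xs ys :: "bool list" assume "length xs \<le> M"
    then have "6 * length xs + 1 \<le> 6 * M + 1" by simp
    with *[of xs ys] show "length (snd (copy_pairs_td xs)) \<le> length xs \<and>
        length (fst (copy_pairs_td xs)) \<le> 6 * M + 1 \<and>
        runs copy_pairs (st xs ys R) (6 * M + 1)
          (st (snd (copy_pairs_td xs)) (ys @ fst (copy_pairs_td xs)) R)"
      by (meson order_trans runs_weaken)
  qed
qed

definition copy_int :: program where
  "copy_int = Seq copy_bit (Seq copy_pairs (Seq consume (emit False)))"

definition copy_int_td :: transducer where
  "copy_int_td = copy_bit_td ;; copy_pairs_td ;; skips ;; outputs [False]"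

lemma implements_copy_int: "implements R M (6 * M + 6) copy_int copy_int_td"
proof -
  have "implements R M (3 + ((6 * M + 1) + (1 + 1))) copy_int copy_int_td"
    unfolding copy_int_def copy_int_td_def
    by (intro implements_Seq implements_copy_bit implements_copy_pairs implements_consume implements_emit)
  then show ?thesis by (simp add: numeral_eq_Suc)
qed

definition jump :: "bool \<Rightarrow> program" where
  "jump c = Seq (emits True [c]) (Seq (scan 5 (move_head 5) (emits True [False]))
     (If 3 is_True (emits True [True, False]) (emits True [False, True, True, False])))"

text \<open>An arc with sign \<open>c\<close> and absolute weight \<open>2 ^ L\<close> or, unless it
  leads home, \<open>2 ^ Suc L\<close>: the zero bits come first, then the leading bit and the end
  mark.\<close>

definition jump_bits :: "bool \<Rightarrow> nat \<Rightarrow> bool \<Rightarrow> bool list" where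
  "jump_bits c L h = [True, c] @ concat (replicate L [True, False]) @
     (if h then [] else [True, False]) @ [True, True, False]"

lemma length_concat_replicate: "length (concat (replicate n ys)) = n * length ys"
  by (induction n) auto

lemma implements_jump:
  assumes R: "R = [N, S, U, seg 0 (int L)]"
  shows "implements R M (6 * L + 12) (jump c) (outputs (jump_bits c L (is_True (S 0))))"
proof -
  let ?pat = "\<lambda>j. concat (replicate j [True, False])"
  let ?K = "\<lambda>k. [N, S, U, seg (- k) (int L - k)]"
  have "implements R M (6 * L + 4) (scan 5 (move_head 5) (emits True [False])) (outputs (?pat L))"
    unfolding implements_def
  proof (intro allI impI conjI)
    fix xs ys :: "bool list"
    have "runs (scan 5 (move_head 5) (emits True [False])) (st xs (ys @ ?pat 0) (?K (int 0)))
        (L * (2 + 2 * 1 + 2) + 2 * 1 + 2) (st xs (ys @ ?pat L) (?K 0))"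
    proof (rule runs_scan[where F = "\<lambda>j. st xs (ys @ ?pat j) (?K (int j))" and
          F' = "\<lambda>j. st xs (ys @ ?pat (Suc j)) (?K (int j))" and
          G = "\<lambda>k. st xs (ys @ ?pat L) (?K k)"])
      fix j
      have "?pat (Suc j) = ?pat j @ [True, False]"
        by (simp only: replicate_Suc replicate_append_same[symmetric]) simp
      then have "runs (emits True [False]) (st xs (ys @ ?pat j) (?K (int j))) 2
          (st xs (ys @ ?pat (Suc j)) (?K (int j)))"
        using implementsD(3)[OF implements_emits[of "?K (int j)" "length xs" "[False]" True] order_refl,
            of "ys @ ?pat j"]
        by (simp add: outputs_def numeral_eq_Suc)
      moreover have "runs (move_head 5 Move_Right) (st xs (ys @ ?pat (Suc j)) (?K (int j))) 1
          (st xs (ys @ ?pat (Suc j)) (?K (int (Suc j))))"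
        by (rule runs_move_head) (auto simp: numeral_eq_Suc intro!: arg_cong2[where f = seg])
      ultimately show "runs (emits True [False]) (st xs (ys @ ?pat j) (?K (int j))) 2
            (st xs (ys @ ?pat (Suc j)) (?K (int j))) \<and>
          runs (move_head 5 Move_Right) (st xs (ys @ ?pat (Suc j)) (?K (int j))) 1
            (st xs (ys @ ?pat (Suc j)) (?K (int (Suc j))))" ..
    next
      fix k m
      show "runs (move_head 5 m) (st xs (ys @ ?pat L) (?K k)) 1 (st xs (ys @ ?pat L) (?K (k + offset m)))"
        by (rule runs_move_head) (auto simp: numeral_eq_Suc algebra_simps)
    qed (auto simp: nonblank_def seg_head)
    then show "runs (scan 5 (move_head 5) (emits True [False])) (st xs ys R) (6 * L + 4)
        (st (snd (outputs (?pat L) xs)) (ys @ fst (outputs (?pat L) xs)) R)"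
      by (simp add: R outputs_def numeral_eq_Suc)
  qed (auto simp: outputs_def length_concat_replicate)
  moreover have "implements R M (Suc 5) (If 3 is_True (emits True [True, False]) (emits True [False, True, True, False]))
      (if is_True ((R ! 1) 0) then outputs [True, True, False] else outputs [True, False, True, True, False])"
    using implements_If[of 1 R M 5 "emits True [True, False]" "outputs [True, True, False]"
        "emits True [False, True, True, False]"]
      implements_weaken[OF implements_emits[of R M "[True, False]"], of 5]
      implements_emits[of R M "[False, True, True, False]"] R
    by (simp add: numeral_eq_Suc)
  moreover have "implements R M 2 (emits True [c]) (outputs [True, c])"
    using implements_emits[of R M "[c]" True] by (simp add: numeral_eq_Suc)
  ultimately have "implements R M (2 + ((6 * L + 4) + Suc 5)) (jump c)
      (outputs [True, c] ;; outputs (?pat L) ;;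
        (if is_True ((R ! 1) 0) then outputs [True, True, False] else outputs [True, False, True, True, False]))"
    unfolding jump_def by (intro implements_Seq)
  moreover have "(outputs [True, c] ;; outputs (?pat L) ;;
        (if is_True ((R ! 1) 0) then outputs [True, True, False] else outputs [True, False, True, True, False])) =
      outputs (jump_bits c L (is_True (S 0)))"
    by (auto simp: R outputs_def seq_td_def jump_bits_def)
  ultimately show ?thesis by (simp add: numeral_eq_Suc)
qed

definition main_entry :: "bool \<Rightarrow> program" where
  "main_entry c = If 0 is_True (Seq consume (Seq (emit True) copy_int)) (Seq consume (jump c))"

definition main_entry_td :: "bool \<Rightarrow> nat \<Rightarrow> bool \<Rightarrow> transducer" where
  "main_entry_td c L h =
     branch (skips ;; outputs [True] ;; copy_int_td) (skips ;; outputs (jump_bits c L h))"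

text \<open>\<open>[True, False, False]\<close> is an arc of weight 0. The row of the other copy
  depends only on the row number and the home node, so no input is consumed.\<close>

definition twin_entry :: "bool \<Rightarrow> program" where
  "twin_entry c = If 4 is_True (emits True [False, False]) (jump c)"

definition twin_entry_td :: "bool \<Rightarrow> nat \<Rightarrow> bool \<Rightarrow> bool \<Rightarrow> transducer" where
  "twin_entry_td c L h d = outputs (if d then [True, False, False] else jump_bits c L h)"

text \<open>The column counter and the markers of home column and row column, at column \<open>k\<close>.\<close>

definition counters :: "nat \<Rightarrow> nat \<Rightarrow> nat \<Rightarrow> nat \<Rightarrow> int \<Rightarrow> tape list" where
  "counters n s u L k =
     [seg (- k) (int n - k), mark (int s - k), mark (int u - k), seg 0 (int L)]"

lemma implements_main_entry:
  "implements (counters n s u L (int v)) M (6 * M + 6 * L + 14) (main_entry c) (main_entry_td c L (v = s))"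
proof -
  let ?R = "counters n s u L (int v)"
  have eq: "is_True (mark (int s - int v) 0) \<longleftrightarrow> v = s"
    by (auto simp: is_True_def mark_head)
  have "implements ?R M (1 + (1 + (6 * M + 6))) (Seq consume (Seq (emit True) copy_int))
      (skips ;; outputs [True] ;; copy_int_td)"
    by (intro implements_Seq implements_consume implements_emit implements_copy_int)
  then have "implements ?R M (6 * M + 6 * L + 13) (Seq consume (Seq (emit True) copy_int))
      (skips ;; outputs [True] ;; copy_int_td)"
    by (rule implements_weaken) simp
  moreover have "implements ?R M (1 + (6 * L + 12)) (Seq consume (jump c)) (skips ;; outputs (jump_bits c L (v = s)))"
    unfolding eq[symmetric]
    by (intro implements_Seq implements_consume implements_jump) (simp add: counters_def)
  then have "implements ?R M (6 * M + 6 * L + 13) (Seq consume (jump c)) (skips ;; outputs (jump_bits c L (v = s)))"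
    by (rule implements_weaken) simp
  ultimately have "implements ?R M (Suc (6 * M + 6 * L + 13)) (main_entry c) (main_entry_td c L (v = s))"
    unfolding main_entry_def main_entry_td_def by (rule implements_branch)
  then show ?thesis by (rule implements_weaken) simp
qed

lemma implements_twin_entry:
  "implements (counters n s u L (int v)) M (6 * M + 6 * L + 14) (twin_entry c) (twin_entry_td c L (v = s) (v = u))"
proof -
  let ?R = "counters n s u L (int v)"
  have eq: "is_True (mark (int s - int v) 0) \<longleftrightarrow> v = s" "is_True (mark (int u - int v) 0) \<longleftrightarrow> v = u"
    by (auto simp: is_True_def mark_head)
  have "implements ?R M (6 * L + 12) (emits True [False, False]) (outputs [True, False, False])"
    by (rule implements_weaken[OF implements_emits]) simp
  moreover have "implements ?R M (6 * L + 12) (jump c) (outputs (jump_bits c L (v = s)))"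
    unfolding eq(1)[symmetric] by (intro implements_jump) (simp add: counters_def)
  ultimately have "implements ?R M (Suc (6 * L + 12)) (If (2 + 2) is_True (emits True [False, False]) (jump c))
      (if is_True ((?R ! 2) 0) then outputs [True, False, False] else outputs (jump_bits c L (v = s)))"
    by (intro implements_If) (auto simp: counters_def)
  moreover have "(if is_True ((?R ! 2) 0) then outputs [True, False, False] else outputs (jump_bits c L (v = s))) =
      twin_entry_td c L (v = s) (v = u)"
    using eq(2) by (auto simp: counters_def twin_entry_td_def)
  ultimately show ?thesis
    unfolding twin_entry_def by (auto elim!: implements_weaken)
qed

section \<open>Rows of the adjacency matrix\<close>

definition columns :: "program \<Rightarrow> program" where
  "columns p = scan 2 (\<lambda>m. Seq (move_head 2 m) (Seq (move_head 3 m) (move_head 4 m))) p"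

primrec columns_td :: "(nat \<Rightarrow> transducer) \<Rightarrow> nat \<Rightarrow> transducer" where
  "columns_td B 0 = outputs []"
| "columns_td B (Suc n) = columns_td B n ;; B n"

lemma implements_columns:
  assumes body: "\<And>v. v < n \<Longrightarrow> implements (counters n s u L (int v)) M T p (B v)"
  shows "implements (counters n s u L 0) M (n * (T + 8) + 8) (columns p) (columns_td B n)"
  unfolding implements_def
proof (intro allI impI)
  fix xs ys :: "bool list" assume xs: "length xs \<le> M"
  let ?mv = "\<lambda>m. Seq (move_head 2 m) (Seq (move_head 3 m) (move_head 4 m))"
  have mv: "runs (?mv m) (st xs' ys' (counters n s u L k)) 3 (st xs' ys' (counters n s u L (k + offset m)))"
    for m k xs' ys'
  proof -
    have "runs (?mv m) (st xs' ys' (counters n s u L k)) (1 + (1 + 1)) (st xs' ys' (counters n s u L (k + offset m)))"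
      by (rule runs_Seq runs_move_head refl | simp add: counters_def)+
        (simp add: counters_def numeral_eq_Suc algebra_simps)
    then show ?thesis by (rule runs_weaken) simp
  qed
  have len: "length (snd (columns_td B j xs)) \<le> length xs \<and> length (fst (columns_td B j xs)) \<le> j * T"
    if "j \<le> n" for j
    using that
  proof (induction j)
    case 0
    then show ?case by (simp add: outputs_def)
  next
    case (Suc j)
    then have IH: "length (snd (columns_td B j xs)) \<le> length xs" "length (fst (columns_td B j xs)) \<le> j * T"
      by auto
    show ?case
      using IH implementsD(1,2)[OF body[of j], of "snd (columns_td B j xs)"] Suc.prems xs
      by (auto simp: seq_td_def)
  qed
  let ?F = "\<lambda>j. st (snd (columns_td B j xs)) (ys @ fst (columns_td B j xs)) (counters n s u L (int j))"
  let ?F' = "\<lambda>j. st (snd (columns_td B (Suc j) xs)) (ys @ fst (columns_td B (Suc j) xs)) (counters n s u L (int j))"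
  let ?G = "\<lambda>k. st (snd (columns_td B n xs)) (ys @ fst (columns_td B n xs)) (counters n s u L k)"
  have "runs (scan 2 ?mv p) (?F 0) (n * (T + 2 * 3 + 2) + 2 * 3 + 2) (?G 0)"
  proof (rule runs_scan[where F = ?F and F' = ?F' and G = ?G])
    fix j assume j: "j < n"
    have "runs p (?F j) T (?F' j)"
      using implementsD(3)[OF body[OF j], of "snd (columns_td B j xs)" "ys @ fst (columns_td B j xs)"]
        len[of j] j xs by (simp add: seq_td_def)
    moreover have "runs (?mv Move_Right) (?F' j) 3 (?F (Suc j))"
      using mv[of Move_Right _ _ "int j"] by (simp add: add.commute)
    ultimately show "runs p (?F j) T (?F' j) \<and> runs (?mv Move_Right) (?F' j) 3 (?F (Suc j))" ..
  next
    show "runs (?mv m) (?G k) 3 (?G (k + offset m))" for k m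
      by (rule mv)
  qed (auto simp: counters_def nonblank_def seg_head)
  then have "runs (columns p) (st xs ys (counters n s u L 0)) (n * (T + 8) + 8) (?G 0)"
    by (simp add: columns_def outputs_def algebra_simps)
  then show "length (snd (columns_td B n xs)) \<le> length xs \<and>
      length (fst (columns_td B n xs)) \<le> n * (T + 8) + 8 \<and>
      runs (columns p) (st xs ys (counters n s u L 0)) (n * (T + 8) + 8) (?G 0)"
    using len[of n] by (auto simp: algebra_simps)
qed

text \<open>The columns come in pairs \<open>2 * v\<close> and \<open>2 * v + 1\<close>. A row of
  Alice has no arc in the even column, a row of Bob none in the odd one.\<close>

definition alice_row :: "program \<Rightarrow> program" where
  "alice_row p = Seq (emit True) (columns (Seq (emit False) p))"

definition bob_row :: "program \<Rightarrow> program" where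
  "bob_row p = Seq (emit False) (columns (Seq p (emit False)))"

definition alice_row_td :: "nat \<Rightarrow> (nat \<Rightarrow> transducer) \<Rightarrow> transducer" where
  "alice_row_td n B = outputs [True] ;; columns_td (\<lambda>v. outputs [False] ;; B v) n"

definition bob_row_td :: "nat \<Rightarrow> (nat \<Rightarrow> transducer) \<Rightarrow> transducer" where
  "bob_row_td n B = outputs [False] ;; columns_td (\<lambda>v. B v ;; outputs [False]) n"

lemma implements_half_row:
  assumes "\<And>v. implements (counters n s u L (int v)) M T p (B v)"
  shows "implements (counters n s u L 0) M (n * (T + 9) + 9) (alice_row p) (alice_row_td n B)"
    and "implements (counters n s u L 0) M (n * (T + 9) + 9) (bob_row p) (bob_row_td n B)"
proof -
  have "implements (counters n s u L 0) M (1 + (n * ((1 + T) + 8) + 8)) (alice_row p) (alice_row_td n B)"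
    unfolding alice_row_def alice_row_td_def
    by (intro implements_Seq implements_emit implements_columns assms)
  then show "implements (counters n s u L 0) M (n * (T + 9) + 9) (alice_row p) (alice_row_td n B)"
    by (rule implements_weaken) simp
  have "implements (counters n s u L 0) M (1 + (n * ((T + 1) + 8) + 8)) (bob_row p) (bob_row_td n B)"
    unfolding bob_row_def bob_row_td_def
    by (intro implements_Seq implements_emit implements_columns assms)
  then show "implements (counters n s u L 0) M (n * (T + 9) + 9) (bob_row p) (bob_row_td n B)"
    by (rule implements_weaken) simp
qed

text \<open>Only the owner's copy reads the input row, so both new rows are written in a single pass
  over it.\<close>

definition row :: program where
  "row = If 0 is_True
     (Seq consume (Seq (alice_row (main_entry True)) (bob_row (twin_entry False))))
     (Seq consume (Seq (alice_row (twin_entry True)) (bob_row (main_entry False))))"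

definition row_td :: "nat \<Rightarrow> nat \<Rightarrow> nat \<Rightarrow> nat \<Rightarrow> transducer" where
  "row_td n s L u =
     branch
       (skips ;; alice_row_td n (\<lambda>v. main_entry_td True L (v = s)) ;;
         bob_row_td n (\<lambda>v. twin_entry_td False L (v = s) (v = u)))
       (skips ;; alice_row_td n (\<lambda>v. twin_entry_td True L (v = s) (v = u)) ;;
         bob_row_td n (\<lambda>v. main_entry_td False L (v = s)))"

definition row_time :: "nat \<Rightarrow> nat \<Rightarrow> nat \<Rightarrow> nat" where
  "row_time n L M = 2 * (n * (6 * M + 6 * L + 23) + 9) + 2"

text \<open>Every row consumes at least its owner bit; therefore \<open>rows\<close> terminates on
  arbitrary words.\<close>

lemma implements_skips_decreases:
  assumes "implements R M T p g" "length xs \<le> M" "xs \<noteq> []"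
  shows "length (snd ((skips ;; g) xs)) < length xs"
  using implementsD(1)[OF assms(1), of "tl xs"] assms(2,3)
  by (cases xs) (auto simp: seq_td_def skips_def)

lemma implements_row:
  shows "implements (counters n s u L 0) M (row_time n L M) row (row_td n s L u)" (is ?I)
    and "length xs \<le> M \<Longrightarrow> xs \<noteq> [] \<Longrightarrow> length (snd (row_td n s L u xs)) < length xs"
proof -
  let ?T = "6 * M + 6 * L + 14"
  note main = implements_half_row[OF implements_main_entry]
  note twin = implements_half_row[OF implements_twin_entry]
  have 1: "implements (counters n s u L 0) M ((n * (?T + 9) + 9) + (n * (?T + 9) + 9))
      (Seq (alice_row (main_entry True)) (bob_row (twin_entry False)))
      (alice_row_td n (\<lambda>v. main_entry_td True L (v = s)) ;;
         bob_row_td n (\<lambda>v. twin_entry_td False L (v = s) (v = u)))"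
    by (intro implements_Seq main twin)
  have 2: "implements (counters n s u L 0) M ((n * (?T + 9) + 9) + (n * (?T + 9) + 9))
      (Seq (alice_row (twin_entry True)) (bob_row (main_entry False)))
      (alice_row_td n (\<lambda>v. twin_entry_td True L (v = s) (v = u)) ;;
         bob_row_td n (\<lambda>v. main_entry_td False L (v = s)))"
    by (intro implements_Seq main twin)
  have "implements (counters n s u L 0) M (Suc (1 + ((n * (?T + 9) + 9) + (n * (?T + 9) + 9)))) row (row_td n s L u)"
    unfolding row_def row_td_def
    by (intro implements_branch implements_Seq[OF implements_consume] 1 2)
  then show ?I
    by (rule implements_weaken) (simp add: row_time_def algebra_simps)
  show "length (snd (row_td n s L u xs)) < length xs" if "length xs \<le> M" "xs \<noteq> []"
    using implements_skips_decreases[OF 1 that] implements_skips_decreases[OF 2 that]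
    by (auto simp: row_td_def branch_def)
qed

definition rows :: program where
  "rows = While 0 nonblank (Seq row (move_head 4 Move_Left))"

text \<open>\<open>k\<close> is fuel. As every row shortens the input, the length of the input is
  enough.\<close>

primrec rows_td :: "nat \<Rightarrow> nat \<Rightarrow> nat \<Rightarrow> nat \<Rightarrow> nat \<Rightarrow> bool list \<Rightarrow> bool list" where
  "rows_td n s L 0 u xs = []"
| "rows_td n s L (Suc k) u xs = (if xs = [] then []
     else fst (row_td n s L u xs) @ rows_td n s L k (Suc u) (snd (row_td n s L u xs)))"

lemma runs_rows:
  assumes "length xs \<le> k" "k \<le> M"
  shows "length (rows_td n s L k u xs) \<le> k * row_time n L M \<and>
    (\<exists>u'. runs rows (st xs ys (counters n s u L 0)) (k * (row_time n L M + 2) + 1)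
      (st [] (ys @ rows_td n s L k u xs) (counters n s u' L 0)))"
  using assms
proof (induction k arbitrary: xs ys u)
  case 0
  then show ?case
    unfolding rows_def by (auto simp: nonblank_def word_tape_head intro!: exI runs_While_False[simplified])
next
  case (Suc k)
  show ?case
  proof (cases "xs = []")
    case True
    then show ?thesis
      unfolding rows_def
      by (auto simp: nonblank_def word_tape_head intro!: exI runs_weaken[OF runs_While_False])
  next
    case False
    let ?T = "row_time n L M" and ?xs = "snd (row_td n s L u xs)"
    let ?ys = "ys @ fst (row_td n s L u xs)"
    have M: "length xs \<le> M" using Suc.prems by simp
    note row = implementsD[OF implements_row(1)[where n = n and s = s and u = u and L = L and M = M] M]
    have "length ?xs < length xs"
      using implements_row(2)[OF M False] .
    then have "length (rows_td n s L k (Suc u) ?xs) \<le> k * ?T \<and>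
        (\<exists>u'. runs rows (st ?xs ?ys (counters n s (Suc u) L 0)) (k * (?T + 2) + 1)
          (st [] (?ys @ rows_td n s L k (Suc u) ?xs) (counters n s u' L 0)))"
      using Suc.prems by (intro Suc.IH) auto
    then obtain u' where len: "length (rows_td n s L k (Suc u) ?xs) \<le> k * ?T"
      and IH: "runs rows (st ?xs ?ys (counters n s (Suc u) L 0)) (k * (?T + 2) + 1)
          (st [] (?ys @ rows_td n s L k (Suc u) ?xs) (counters n s u' L 0))"
      by blast
    have "runs (move_head 4 Move_Left) (st ?xs ?ys (counters n s u L 0)) 1 (st ?xs ?ys (counters n s (Suc u) L 0))"
      by (rule runs_move_head) (auto simp: counters_def numeral_eq_Suc add.commute)
    then have "runs (Seq row (move_head 4 Move_Left)) (st xs ys (counters n s u L 0)) (?T + 1)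
        (st ?xs ?ys (counters n s (Suc u) L 0))"
      by (rule runs_Seq[OF row(3)])
    then have "runs rows (st xs ys (counters n s u L 0)) (Suc ((?T + 1) + (k * (?T + 2) + 1)))
        (st [] (?ys @ rows_td n s L k (Suc u) ?xs) (counters n s u' L 0))"
      unfolding rows_def
      by (rule runs_While_True[rotated 2])
        (use IH False in \<open>auto simp: rows_def nonblank_def word_tape_head split: list.split\<close>)
    then have "runs rows (st xs ys (counters n s u L 0)) (Suc k * (?T + 2) + 1)
        (st [] (ys @ rows_td n s L (Suc k) u xs) (counters n s u' L 0))"
      using False by (auto elim!: runs_weaken)
    then show ?thesis
      using len row(2) False by auto
  qed
qed

section \<open>The two unary numbers, the input length and the complete program\<close>

definition unary :: "program \<Rightarrow> program" where
  "unary p = Seq (While 0 is_True (Seq (Seq consume (emits True [True])) p)) (Seq consume (emit False))"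

text \<open>The output is doubled because there are \<open>2 * n\<close> new nodes and the new home
  is \<open>2 * s\<close>. Meanwhile \<open>p\<close> records the original number on an auxiliary
  tape.\<close>

lemma runs_unary:
  assumes p: "\<And>j xs ys. runs p (st xs ys (R j)) 1 (st xs ys (R (Suc j)))"
  shows "runs (unary p) (st xs ys (R 0)) (5 * length xs + 3)
    (st (tl (dropWhile id xs)) (ys @ replicate (2 * length (takeWhile id xs)) True @ [False])
      (R (length (takeWhile id xs))))"
proof -
  let ?m = "length (takeWhile id xs)"
  let ?F = "\<lambda>j. st (drop j xs) (ys @ replicate (2 * j) True) (R j)"
  have "runs (While 0 is_True (Seq (Seq consume (emits True [True])) p)) (?F 0) (?m * Suc 4 + 1) (?F ?m)"
  proof (rule runs_While_iterate)
    fix j assume j: "j < ?m"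
    then have "xs ! j"
      using nth_mem[of j "takeWhile id xs"] takeWhile_nth[of j id xs] set_takeWhileD[of _ id xs] by auto
    moreover have "j < length xs"
      using j length_takeWhile_le[of id xs] by linarith
    ultimately have drop: "drop j xs = True # drop (Suc j) xs"
      by (metis Cons_nth_drop_Suc)
    have "implements (R j) (length xs) (1 + 2) (Seq consume (emits True [True])) (skips ;; outputs [True, True])"
      using implements_emits[of "R j" "length xs" "[True]" True]
      by (intro implements_Seq implements_consume) (simp add: numeral_eq_Suc)
    from implementsD(3)[OF this, of "drop j xs" "ys @ replicate (2 * j) True"]
    have "runs (Seq consume (emits True [True])) (?F j) 3
        (st (drop (Suc j) xs) ((ys @ replicate (2 * j) True) @ [True, True]) (R j))"
      using \<open>j < length xs\<close>
      by (simp add: drop seq_td_def skips_def outputs_def Suc_diff_Suc numeral_3_eq_3 del: emits.simps)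
    moreover have "replicate (2 * Suc j) True = replicate (2 * j) True @ [True, True]"
      using replicate_add[of "2 * j" 2 True] by (simp add: numeral_2_eq_2)
    ultimately have "runs (Seq consume (emits True [True])) (?F j) 3
        (st (drop (Suc j) xs) (ys @ replicate (2 * Suc j) True) (R j))"
      by simp
    then have "runs (Seq (Seq consume (emits True [True])) p) (?F j) (3 + 1) (?F (Suc j))"
      using p by (rule runs_Seq)
    then show "is_True ((?F j ! 0) 0) \<and> runs (Seq (Seq consume (emits True [True])) p) (?F j) 4 (?F (Suc j))"
      using drop by (simp add: is_True_def word_tape_head)
  next
    have "is_True (word_tape (dropWhile id xs) 0) = False"
    proof (cases "dropWhile id xs")
      case Nil
      show ?thesis unfolding Nil by (simp add: is_True_def word_tape_head)
    next
      case (Cons b bs)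
      then have "\<not> b"
        using hd_dropWhile[of id xs] by simp
      then show ?thesis
        by (simp add: Cons is_True_def word_tape_head)
    qed
    then show "\<not> is_True ((?F ?m ! 0) 0)"
      by (simp add: dropWhile_eq_drop)
  qed simp
  moreover have "runs (Seq consume (emit False)) (?F ?m) (1 + 1)
     (st (tl (dropWhile id xs)) ((ys @ replicate (2 * ?m) True) @ [False]) (R ?m))"
    using implementsD(3)[OF implements_Seq[OF implements_consume[of "R ?m" "length (drop ?m xs)"]
          implements_emit[of _ _ False]] order_refl, of "ys @ replicate (2 * ?m) True"]
    by (simp add: seq_td_def skips_def outputs_def dropWhile_eq_drop)
  ultimately have "runs (unary p) (?F 0) ((?m * Suc 4 + 1) + (1 + 1))
     (st (tl (dropWhile id xs)) ((ys @ replicate (2 * ?m) True) @ [False]) (R ?m))"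
    unfolding unary_def by (rule runs_Seq)
  then show ?thesis
    using length_takeWhile_le[of id xs] by (auto elim!: runs_weaken)
qed


definition push :: "nat \<Rightarrow> program" where
  "push i = Op i (\<lambda>_. (Some True, Move_Left))"

definition set_mark :: "nat \<Rightarrow> program" where
  "set_mark i = Op i (\<lambda>_. (Some True, No_Move))"

text \<open>The exponent of the jump price is the length of the whole input, so it is recorded
  before anything is consumed.\<close>

definition measure_input :: program where
  "measure_input = Seq (scan 0 (move_head 0) (push 5)) (move_head 5 Move_Right)"

lemma runs_measure_input:
  "runs measure_input (word_tape x # replicate 5 (word_tape [])) (5 * length x + 5)
     (st x [] [seg 1 1, word_tape [], word_tape [], seg 0 (int (length x))])"
proof -
  let ?E = "word_tape []"
  let ?F = "\<lambda>j k. [shift k (word_tape x), ?E, ?E, ?E, ?E, seg 1 (1 + int j)]"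
  have "runs (scan 0 (move_head 0) (push 5)) (?F 0 (int 0)) (length x * (1 + 2 * 1 + 2) + 2 * 1 + 2) (?F (length x) 0)"
  proof (rule runs_scan[where F = "\<lambda>j. ?F j (int j)" and F' = "\<lambda>j. ?F (Suc j) (int j)" and G = "?F (length x)"])
    fix j
    have "runs (push 5) (?F j (int j)) 1 (?F (Suc j) (int j))"
      unfolding push_def by (rule runs_Op) (auto simp: numeral_eq_Suc act_push[simplified] add.commute)
    moreover have "runs (move_head 0 Move_Right) (?F (Suc j) (int j)) 1 (?F (Suc j) (int (Suc j)))"
      by (rule runs_move_head) auto
    ultimately show "runs (push 5) (?F j (int j)) 1 (?F (Suc j) (int j)) \<and>
        runs (move_head 0 Move_Right) (?F (Suc j) (int j)) 1 (?F (Suc j) (int (Suc j)))" ..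
  next
    show "runs (move_head 0 m) (?F (length x) k) 1 (?F (length x) (k + offset m))" for k m
      by (rule runs_move_head) (auto simp: add.commute)
  qed (auto simp: nonblank_def shift_word_tape_head)
  moreover have "runs (move_head 5 Move_Right) (?F (length x) 0) 1
      (st x [] [seg 1 1, word_tape [], word_tape [], seg 0 (int (length x))])"
    by (rule runs_move_head) (auto simp: numeral_eq_Suc written_def word_tape_Nil_seg)
  ultimately have "runs measure_input (?F 0 (int 0)) ((length x * (1 + 2 * 1 + 2) + 2 * 1 + 2) + 1)
      (st x [] [seg 1 1, word_tape [], word_tape [], seg 0 (int (length x))])"
    unfolding measure_input_def by (rule runs_Seq)
  moreover have "?F 0 (int 0) = word_tape x # replicate 5 (word_tape [])"
    by (simp add: numeral_eq_Suc word_tape_Nil_seg)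
  ultimately show ?thesis
    by (auto elim!: runs_weaken)
qed

text \<open>Copying from right to left leaves the head on the first symbol, where
  \<open>halts_with\<close> expects it. By then tape 0 is blank, since \<open>rows\<close> consumes
  all input.\<close>

definition copy_back :: program where
  "copy_back = Seq (move_head 1 Move_Left) (Seq
     (While 1 nonblank (Seq (If 1 is_True (Op 0 (\<lambda>_. (Some True, Move_Left))) (Op 0 (\<lambda>_. (Some False, Move_Left))))
       (move_head 1 Move_Left)))
     (move_head 0 Move_Right))"

lemma runs_copy_back:
  "\<exists>R'. runs copy_back (st [] ys R) (4 * length ys + 3) (word_tape ys # R')"
proof -
  let ?n = "length ys"
  let ?W = "If 1 is_True (Op 0 (\<lambda>_. (Some True, Move_Left))) (Op 0 (\<lambda>_. (Some False, Move_Left)))"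
  let ?F = "\<lambda>j. shift (-1) (word_tape (drop (?n - j) ys)) # shift (int ?n - 1 - int j) (word_tape ys) # R"
  have "runs (move_head 1 Move_Left) (st [] ys R) 1 (?F 0)"
    by (rule runs_move_head) (auto simp: written_def word_tape_Nil_shift)
  moreover have "runs (While 1 nonblank (Seq ?W (move_head 1 Move_Left))) (?F 0) (?n * Suc 3 + 1) (?F ?n)"
  proof (rule runs_While_iterate)
    fix j assume j: "j < ?n"
    let ?i = "?n - Suc j"
    have drop: "drop ?i ys = ys ! ?i # drop (?n - j) ys"
      using Cons_nth_drop_Suc[of ?i ys] j by (simp add: Suc_diff_Suc)
    have nat: "nat (int ?n - 1 - int j) = ?i"
      by (simp add: nat_diff_distrib)
    let ?F' = "shift (-1) (word_tape (drop ?i ys)) # shift (int ?n - 1 - int j) (word_tape ys) # R"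
    have head: "shift (int ?n - 1 - int j) (word_tape ys) 0 = Some (ys ! ?i)"
      using j nat by (auto simp: shift_word_tape_head)
    have "runs ?W (?F j) (Suc 1) ?F'"
    proof (rule runs_If)
      show "runs (Op 0 (\<lambda>_. (Some True, Move_Left))) (?F j) 1 ?F'" if "is_True ((?F j ! 1) 0)"
        using that by (intro runs_Op) (auto simp: head is_True_def drop act_prepend)
      show "runs (Op 0 (\<lambda>_. (Some False, Move_Left))) (?F j) 1 ?F'" if "\<not> is_True ((?F j ! 1) 0)"
        using that by (intro runs_Op) (auto simp: head is_True_def drop act_prepend)
    qed simp
    moreover have "runs (move_head 1 Move_Left) ?F' 1 (?F (Suc j))"
      by (rule runs_move_head) (auto simp: algebra_simps)
    ultimately have "runs (Seq ?W (move_head 1 Move_Left)) (?F j) (Suc 1 + 1) (?F (Suc j))"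
      by (rule runs_Seq)
    then show "nonblank ((?F j ! 1) 0) \<and> runs (Seq ?W (move_head 1 Move_Left)) (?F j) 3 (?F (Suc j))"
      using head by (simp add: nonblank_def numeral_3_eq_3)
  qed (auto simp: nonblank_def shift_word_tape_head)
  moreover have "runs (move_head 0 Move_Right) (?F ?n) 1 (word_tape ys # tl (?F ?n))"
    by (rule runs_move_head) auto
  ultimately have "runs copy_back (st [] ys R) (1 + ((?n * Suc 3 + 1) + 1)) (word_tape ys # tl (?F ?n))"
    unfolding copy_back_def by (intro runs_Seq)
  then have "runs copy_back (st [] ys R) (4 * length ys + 3) (word_tape ys # tl (?F ?n))"
    by (rule runs_weaken) simp
  then show ?thesis by blast
qed

definition bipartite_program :: program where
  "bipartite_program = Seq measure_input (Seq (unary (push 2)) (Seq (move_head 2 Move_Right)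
     (Seq (set_mark 3) (Seq (set_mark 4) (Seq (unary (move_head 3 Move_Left)) (Seq rows copy_back))))))"

text \<open>It is defined on every word because \<open>polytime_computable\<close> bounds the run on
  all words, not just on encodings. Of the two arguments \<open>length x\<close>, the first sets the
  jump price and the second is fuel.\<close>

definition bipartite_code :: "bool list \<Rightarrow> bool list" where
  "bipartite_code x =
     (let n = length (takeWhile id x); y = tl (dropWhile id x);
        s = length (takeWhile id y); z = tl (dropWhile id y)
      in replicate (2 * n) True @ [False] @ replicate (2 * s) True @ [False] @
        rows_td n s (length x) (length x) 0 z)"

lemma polytime_bipartite_code: "polytime_computable bipartite_code"
\<comment> \<open>The polynomial is five times the bound on \<open>length x * row_time\<close>, once
  for writing the rows and four times for copying them back, plus linear terms.\<close>
proof (rule polytime_computableI[where P = "[:26, 133, 230, 120:]"])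
  fix x :: "bool list"
  let ?l = "length x" and ?E = "word_tape []"
  define n where "n = length (takeWhile id x)"
  define y where "y = tl (dropWhile id x)"
  define s where "s = length (takeWhile id y)"
  define z where "z = tl (dropWhile id y)"
  have "length (dropWhile id x) \<le> ?l" "length (dropWhile id y) \<le> length y"
    by (rule length_dropWhile_le)+
  then have len: "n \<le> ?l" "length y \<le> ?l" "length z \<le> ?l"
    using length_takeWhile_le[of id x] by (auto simp: n_def y_def z_def)
  then have s: "s \<le> ?l"
    using length_takeWhile_le[of id y] by (simp add: s_def)
  let ?o1 = "replicate (2 * n) True @ [False]" and ?o2 = "replicate (2 * s) True @ [False]"
  let ?o3 = "rows_td n s ?l ?l 0 z" and ?T = "row_time n ?l ?l"
  have code: "bipartite_code x = ((?o1 @ ?o2) @ ?o3)"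
    by (simp add: bipartite_code_def Let_def n_def y_def s_def z_def)
  let ?R1 = "\<lambda>j. [seg 1 (1 + int j), ?E, ?E, seg 0 (int ?l)]"
  have "runs (push 2) (st xs ys (?R1 j)) 1 (st xs ys (?R1 (Suc j)))" for xs ys j
    unfolding push_def by (rule runs_Op) (auto simp: numeral_eq_Suc act_push[simplified] add.commute)
  then have "runs (unary (push 2)) (st x [] (?R1 0)) (5 * ?l + 3) (st y ?o1 (?R1 n))"
    using runs_unary[of "push 2" ?R1 x "[]"] by (simp add: y_def n_def)
  then have 1: "runs (unary (push 2)) (st x [] [seg 1 1, ?E, ?E, seg 0 (int ?l)]) (5 * ?l + 3) (st y ?o1 (?R1 n))"
    by simp
  have 2: "runs (move_head 2 Move_Right) (st y ?o1 (?R1 n)) 1 (st y ?o1 [seg 0 (int n), ?E, ?E, seg 0 (int ?l)])"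
    by (rule runs_move_head) (auto simp: numeral_eq_Suc)
  have 3: "runs (set_mark 3) (st y ?o1 [seg 0 (int n), ?E, ?E, seg 0 (int ?l)]) 1
      (st y ?o1 [seg 0 (int n), mark 0, ?E, seg 0 (int ?l)])"
    unfolding set_mark_def by (rule runs_Op) (auto simp: numeral_eq_Suc act_mark)
  have 4: "runs (set_mark 4) (st y ?o1 [seg 0 (int n), mark 0, ?E, seg 0 (int ?l)]) 1
      (st y ?o1 [seg 0 (int n), mark (int 0), mark 0, seg 0 (int ?l)])"
    unfolding set_mark_def by (rule runs_Op) (auto simp: numeral_eq_Suc act_mark)
  let ?R2 = "\<lambda>j. [seg 0 (int n), mark (int j), mark 0, seg 0 (int ?l)]"
  have "runs (move_head 3 Move_Left) (st xs ys (?R2 j)) 1 (st xs ys (?R2 (Suc j)))" for xs ys j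
    by (rule runs_move_head) (auto simp: numeral_eq_Suc add.commute)
  then have "runs (unary (move_head 3 Move_Left)) (st y ?o1 (?R2 0)) (5 * length y + 3) (st z (?o1 @ ?o2) (?R2 s))"
    using runs_unary[of "move_head 3 Move_Left" ?R2 y ?o1] by (simp add: s_def z_def)
  then have 5: "runs (unary (move_head 3 Move_Left)) (st y ?o1 (?R2 0)) (5 * ?l + 3)
      (st z (?o1 @ ?o2) (counters n s 0 ?l 0))"
    using len(2) by (auto simp: counters_def elim!: runs_weaken)
  obtain u where len3: "length ?o3 \<le> ?l * ?T"
    and 6: "runs rows (st z (?o1 @ ?o2) (counters n s 0 ?l 0)) (?l * (?T + 2) + 1)
      (st [] (bipartite_code x) (counters n s u ?l 0))"
    using runs_rows[OF len(3) order_refl, of n s ?l 0 "?o1 @ ?o2"] code by auto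
  obtain R where 7: "runs copy_back (st [] (bipartite_code x) (counters n s u ?l 0))
      (4 * length (bipartite_code x) + 3) (word_tape (bipartite_code x) # R)"
    using runs_copy_back by blast
  have "runs bipartite_program (word_tape x # replicate 5 ?E)
      ((5 * ?l + 5) + ((5 * ?l + 3) + (1 + (1 + (1 + ((5 * ?l + 3) +
        ((?l * (?T + 2) + 1) + (4 * length (bipartite_code x) + 3))))))))
      (word_tape (bipartite_code x) # R)"
    unfolding bipartite_program_def
    by (rule runs_Seq[OF runs_measure_input] runs_Seq[OF 1] runs_Seq[OF 2] runs_Seq[OF 3]
        runs_Seq[OF 4] runs_Seq[OF 5] runs_Seq[OF 6] 7)+
  moreover have "(5 * ?l + 5) + ((5 * ?l + 3) + (1 + (1 + (1 + ((5 * ?l + 3) +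
        ((?l * (?T + 2) + 1) + (4 * length (bipartite_code x) + 3))))))) \<le>
      poly [:26, 133, 230, 120:] ?l"
  proof -
    have "?T \<le> 2 * (?l * (6 * ?l + 6 * ?l + 23) + 9) + 2"
      unfolding row_time_def using mult_right_mono[OF len(1), of "6 * ?l + 6 * ?l + 23"] by simp
    then have "?l * ?T \<le> ?l * (2 * (?l * (6 * ?l + 6 * ?l + 23) + 9) + 2)"
      by (rule mult_left_mono) simp
    also have "\<dots> = 24 * (?l * (?l * ?l)) + 46 * (?l * ?l) + 20 * ?l"
      by (simp add: algebra_simps)
    finally have T: "?l * ?T \<le> 24 * (?l * (?l * ?l)) + 46 * (?l * ?l) + 20 * ?l" .
    have "length (bipartite_code x) \<le> 4 * ?l + 2 + ?l * ?T"
      using len(1) s len3 by (simp add: code)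
    moreover have "?l * (?T + 2) = ?l * ?T + 2 * ?l"
      by (simp add: algebra_simps)
    moreover have "poly [:26, 133, 230, 120:] ?l = 26 + 133 * ?l + 230 * (?l * ?l) + 120 * (?l * (?l * ?l))"
      by (simp add: algebra_simps)
    ultimately show ?thesis
      using T by linarith
  qed
  ultimately show "\<exists>R. runs bipartite_program (word_tape x # replicate 5 ?E)
      (poly [:26, 133, 230, 120:] (length x)) (word_tape (bipartite_code x) # R)"
    using runs_weaken by blast
qed


section \<open>Correctness of the program\<close>

text \<open>The arbitrary rest \<open>zs\<close> says that exactly \<open>xs\<close> is consumed,
  which is what makes the statements compose.\<close>

definition maps_to :: "transducer \<Rightarrow> bool list \<Rightarrow> bool list \<Rightarrow> bool" where
  "maps_to g xs ys \<longleftrightarrow> (\<forall>zs. g (xs @ zs) = (ys, zs))"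

lemma maps_to_seq: "maps_to g xs ys \<Longrightarrow> maps_to h xs' ys' \<Longrightarrow> maps_to (g ;; h) (xs @ xs') (ys @ ys')"
  by (simp add: maps_to_def seq_td_def)

lemma maps_to_outputs: "maps_to (outputs ys) [] ys"
  by (simp add: maps_to_def outputs_def)

lemma maps_to_columns:
  assumes "\<And>v. v < n \<Longrightarrow> maps_to (B v) (f v) (g v)"
  shows "maps_to (columns_td B n) (concat (map f [0..<n])) (concat (map g [0..<n]))"
  using assms
proof (induction n)
  case 0
  then show ?case by (simp add: maps_to_outputs)
next
  case (Suc n)
  then show ?case by (auto intro!: maps_to_seq)
qed

lemma maps_to_copy_nat:
  "maps_to (copy_pairs_td ;; skips ;; outputs [False]) (encode_nat m) (encode_nat m)"
proof (induction m rule: encode_nat.induct)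
  case (1 m)
  show ?case
  proof (cases "m = 0")
    case True
    then show ?thesis
      by (simp add: maps_to_def seq_td_def skips_def outputs_def encode_nat.simps[of 0])
  next
    case False
    from 1[OF this] show ?thesis
      using False by (simp add: maps_to_def seq_td_def skips_def outputs_def encode_nat.simps[of m] prod_eq_iff)
  qed
qed

lemma maps_to_copy_int: "maps_to copy_int_td (encode_int k) (encode_int k)"
proof -
  have "maps_to copy_bit_td [k < 0] [k < 0]"
    by (simp add: maps_to_def copy_bit_td_def)
  from maps_to_seq[OF this maps_to_copy_nat] show ?thesis
    by (simp add: copy_int_td_def encode_int_def)
qed

lemma encode_nat_power: "encode_nat (2 ^ L) = concat (replicate L [True, False]) @ [True, True, False]"
proof (induction L)
  case 0
  show ?case by (simp add: encode_nat.simps[of "Suc 0"] encode_nat.simps[of 0])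
next
  case (Suc L)
  then show ?case by (simp add: encode_nat.simps[of "2 * 2 ^ L"])
qed

lemma jump_bits_eq:
  "jump_bits c L h =
     True # encode_int (if c then - (if h then 2 ^ L else 2 * 2 ^ L) else (if h then 2 ^ L else 2 * 2 ^ L))"
proof -
  have "encode_nat (nat (2 ^ L)) = concat (replicate L [True, False]) @ [True, True, False]"
    by (simp add: nat_power_eq encode_nat_power)
  moreover have "concat (replicate L [True, False]) @ [True, False] = concat (replicate (Suc L) [True, False])"
    by (simp only: replicate_Suc replicate_append_same[symmetric]) simp
  then have "encode_nat (nat (2 * 2 ^ L)) =
      concat (replicate L [True, False]) @ [True, False, True, True, False]"
    using encode_nat_power[of "Suc L"] by (simp add: nat_power_eq nat_mult_distrib)
  ultimately show ?thesis
    by (auto simp: jump_bits_def encode_int_def not_less)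
qed

lemma concat_map_double:
  "concat (map f [0..<2 * n]) = concat (map (\<lambda>v. f (2 * v) @ f (2 * v + 1)) [0..<n])"
  by (induction n) simp_all

lemma encode_entry_bipartite_game:
  assumes "u < n" "v < n" "card (pverts (arena \<Gamma>)) = n"
  shows "encode_entry (bipartite_game K \<Gamma> s) (2 * u, 2 * v) = [False]"
    "encode_entry (bipartite_game K \<Gamma> s) (2 * u + 1, 2 * v + 1) = [False]"
    "encode_entry (bipartite_game K \<Gamma> s) (2 * u, 2 * v + 1) =
       True # encode_int (bipartite_weight K \<Gamma> s (2 * u, 2 * v + 1))"
    "encode_entry (bipartite_game K \<Gamma> s) (2 * u + 1, 2 * v) =
       True # encode_int (bipartite_weight K \<Gamma> s (2 * u + 1, 2 * v))"
  using assms by (auto simp: encode_entry_def bipartite_game_def Let_def)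

lemma encode_row_bipartite_game:
  assumes "u < n" "card (pverts (arena \<Gamma>)) = n"
  shows "encode_row (bipartite_game K \<Gamma> s) (2 * n) (2 * u) =
      True # concat (map (\<lambda>v. False # True # encode_int (bipartite_weight K \<Gamma> s (2 * u, 2 * v + 1))) [0..<n])"
    "encode_row (bipartite_game K \<Gamma> s) (2 * n) (2 * u + 1) =
      False # concat (map (\<lambda>v. True # encode_int (bipartite_weight K \<Gamma> s (2 * u + 1, 2 * v)) @ [False]) [0..<n])"
proof -
  note entry = encode_entry_bipartite_game[OF assms(1) _ assms(2), of _ K s]
  have "2 * u \<in> alice (bipartite_game K \<Gamma> s)"
    using assms by (simp add: bipartite_game_def Let_def)
  moreover have "concat (map (\<lambda>v. encode_entry (bipartite_game K \<Gamma> s) (2 * u, 2 * v) @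
        encode_entry (bipartite_game K \<Gamma> s) (2 * u, 2 * v + 1)) [0..<n]) =
      concat (map (\<lambda>v. False # True # encode_int (bipartite_weight K \<Gamma> s (2 * u, 2 * v + 1))) [0..<n])"
    by (intro arg_cong[where f = concat] map_cong refl) (simp only: entry set_upt atLeastLessThan_iff, simp)
  ultimately show "encode_row (bipartite_game K \<Gamma> s) (2 * n) (2 * u) =
      True # concat (map (\<lambda>v. False # True # encode_int (bipartite_weight K \<Gamma> s (2 * u, 2 * v + 1))) [0..<n])"
    unfolding encode_row_def concat_map_double by simp
  have "2 * u + 1 \<notin> alice (bipartite_game K \<Gamma> s)"
    by (simp add: bipartite_game_def Let_def)
  moreover have "concat (map (\<lambda>v. encode_entry (bipartite_game K \<Gamma> s) (2 * u + 1, 2 * v) @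
        encode_entry (bipartite_game K \<Gamma> s) (2 * u + 1, 2 * v + 1)) [0..<n]) =
      concat (map (\<lambda>v. True # encode_int (bipartite_weight K \<Gamma> s (2 * u + 1, 2 * v)) @ [False]) [0..<n])"
    by (intro arg_cong[where f = concat] map_cong refl) (simp only: entry set_upt atLeastLessThan_iff, simp)
  ultimately show "encode_row (bipartite_game K \<Gamma> s) (2 * n) (2 * u + 1) =
      False # concat (map (\<lambda>v. True # encode_int (bipartite_weight K \<Gamma> s (2 * u + 1, 2 * v)) @ [False]) [0..<n])"
    unfolding encode_row_def concat_map_double by simp
qed

lemma maps_to_main_entry:
  assumes "u \<in> alice \<Gamma> \<longleftrightarrow> even x" "x div 2 = u" "y div 2 = v" "even x \<longleftrightarrow> odd y"
  shows "maps_to (main_entry_td (even x) L (v = s)) (encode_entry \<Gamma> (u, v))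
    (True # encode_int (bipartite_weight (2 ^ L) \<Gamma> s (x, y)))"
proof (cases "(u, v) \<in> parcs (arena \<Gamma>)")
  case True
  have "maps_to (skips ;; outputs [True] ;; copy_int_td)
      ([True] @ [] @ encode_int (weight \<Gamma> (u, v))) ([] @ [True] @ encode_int (weight \<Gamma> (u, v)))"
    by (intro maps_to_seq maps_to_outputs maps_to_copy_int) (simp add: maps_to_def skips_def)
  with True show ?thesis
    using assms by (auto simp: main_entry_td_def maps_to_def branch_def encode_entry_def bipartite_weight_def Let_def)
next
  case False
  have "maps_to (skips ;; outputs (jump_bits (even x) L (v = s))) ([False] @ []) ([] @ jump_bits (even x) L (v = s))"
    by (intro maps_to_seq maps_to_outputs) (simp add: maps_to_def skips_def)
  moreover have "bipartite_weight (2 ^ L) \<Gamma> s (x, y) =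
      (if even x then - (if v = s then 2 ^ L else 2 * 2 ^ L) else (if v = s then 2 ^ L else 2 * 2 ^ L))"
    using assms False by (auto simp: bipartite_weight_def Let_def)
  ultimately show ?thesis
    using False by (auto simp: main_entry_td_def maps_to_def branch_def encode_entry_def jump_bits_eq)
qed

lemma maps_to_twin_entry:
  assumes "u \<in> alice \<Gamma> \<longleftrightarrow> odd x" "x div 2 = u" "y div 2 = v"
  shows "maps_to (twin_entry_td (even x) L (v = s) (v = u)) []
    (True # encode_int (bipartite_weight (2 ^ L) \<Gamma> s (x, y)))"
proof -
  have "bipartite_weight (2 ^ L) \<Gamma> s (x, y) = (if v = u then 0 else
      if even x then - (if v = s then 2 ^ L else 2 * 2 ^ L) else (if v = s then 2 ^ L else 2 * 2 ^ L))"
    using assms by (auto simp: bipartite_weight_def Let_def)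
  moreover have "True # encode_int 0 = [True, False, False]"
    by (simp add: encode_int_def encode_nat.simps[of 0])
  ultimately show ?thesis
    unfolding twin_entry_td_def jump_bits_eq
    by (auto simp: maps_to_def outputs_def)
qed

lemma maps_to_row:
  assumes "u < n" "card (pverts (arena \<Gamma>)) = n"
  shows "maps_to (row_td n s L u) (encode_row \<Gamma> n u)
    (encode_row (bipartite_game (2 ^ L) \<Gamma> s) (2 * n) (2 * u) @
     encode_row (bipartite_game (2 ^ L) \<Gamma> s) (2 * n) (2 * u + 1))"
proof -
  let ?a = "\<lambda>v. True # encode_int (bipartite_weight (2 ^ L) \<Gamma> s (2 * u, 2 * v + 1))"
  let ?b = "\<lambda>v. True # encode_int (bipartite_weight (2 ^ L) \<Gamma> s (2 * u + 1, 2 * v))"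
  let ?row = "concat (map (\<lambda>v. encode_entry \<Gamma> (u, v)) [0..<n])"
  have alice: "maps_to (alice_row_td n B) (concat (map f [0..<n])) (encode_row (bipartite_game (2 ^ L) \<Gamma> s) (2 * n) (2 * u))"
    if "\<And>v. maps_to (B v) (f v) (?a v)" for B f
  proof -
    have "maps_to (alice_row_td n B) ([] @ concat (map (\<lambda>v. [] @ f v) [0..<n]))
        ([True] @ concat (map (\<lambda>v. [False] @ ?a v) [0..<n]))"
      unfolding alice_row_td_def by (intro maps_to_seq maps_to_outputs maps_to_columns that)
    then show ?thesis
      by (simp add: encode_row_bipartite_game[OF assms])
  qed
  have bob: "maps_to (bob_row_td n B) (concat (map f [0..<n])) (encode_row (bipartite_game (2 ^ L) \<Gamma> s) (2 * n) (2 * u + 1))"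
    if "\<And>v. maps_to (B v) (f v) (?b v)" for B f
  proof -
    have "maps_to (bob_row_td n B) ([] @ concat (map (\<lambda>v. f v @ []) [0..<n]))
        ([False] @ concat (map (\<lambda>v. ?b v @ [False]) [0..<n]))"
      unfolding bob_row_td_def by (intro maps_to_seq maps_to_outputs maps_to_columns that)
    then show ?thesis
      by (simp add: encode_row_bipartite_game[OF assms, simplified])
  qed
  have skips: "maps_to skips [x] []" for x
    by (simp add: maps_to_def skips_def)
  \<comment> \<open>The other copy's row consumes an empty word in each column; in this form it fits
    \<open>maps_to_columns\<close>.\<close>
  have twins: "concat (map (\<lambda>v. []) [0..<n]) = []"
    by simp
  show ?thesis
  proof (cases "u \<in> alice \<Gamma>")
    case True
    have "maps_to (skips ;; alice_row_td n (\<lambda>v. main_entry_td True L (v = s)) ;;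
         bob_row_td n (\<lambda>v. twin_entry_td False L (v = s) (v = u)))
        ([True] @ ?row @ concat (map (\<lambda>v. []) [0..<n]))
        ([] @ encode_row (bipartite_game (2 ^ L) \<Gamma> s) (2 * n) (2 * u) @
         encode_row (bipartite_game (2 ^ L) \<Gamma> s) (2 * n) (2 * u + 1))"
    proof (intro maps_to_seq skips alice bob)
      show "maps_to (main_entry_td True L (v = s)) (encode_entry \<Gamma> (u, v)) (?a v)" for v
        using maps_to_main_entry[of u \<Gamma> "2 * u" "2 * v + 1" v L s] True by simp
      show "maps_to (twin_entry_td False L (v = s) (v = u)) [] (?b v)" for v
        using maps_to_twin_entry[of u \<Gamma> "2 * u + 1" "2 * v" v L s] True by simp
    qed
    with True show ?thesis
      unfolding twins by (simp add: maps_to_def row_td_def branch_def encode_row_def[of \<Gamma>])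
  next
    case False
    have "maps_to (skips ;; alice_row_td n (\<lambda>v. twin_entry_td True L (v = s) (v = u)) ;;
         bob_row_td n (\<lambda>v. main_entry_td False L (v = s)))
        ([False] @ concat (map (\<lambda>v. []) [0..<n]) @ ?row)
        ([] @ encode_row (bipartite_game (2 ^ L) \<Gamma> s) (2 * n) (2 * u) @
         encode_row (bipartite_game (2 ^ L) \<Gamma> s) (2 * n) (2 * u + 1))"
    proof (intro maps_to_seq skips alice bob)
      show "maps_to (twin_entry_td True L (v = s) (v = u)) [] (?a v)" for v
        using maps_to_twin_entry[of u \<Gamma> "2 * u" "2 * v + 1" v L s] False by simp
      show "maps_to (main_entry_td False L (v = s)) (encode_entry \<Gamma> (u, v)) (?b v)" for v
        using maps_to_main_entry[of u \<Gamma> "2 * u + 1" "2 * v" v L s] False by simp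
    qed
    with False show ?thesis
      unfolding twins by (simp add: maps_to_def row_td_def branch_def encode_row_def[of \<Gamma>])
  qed
qed

lemma rows_td_encode:
  assumes "card (pverts (arena \<Gamma>)) = n" "u + m = n" "m \<le> k"
  shows "rows_td n s L k u (concat (map (encode_row \<Gamma> n) [u..<n])) =
    concat (map (\<lambda>u. encode_row (bipartite_game (2 ^ L) \<Gamma> s) (2 * n) (2 * u) @
      encode_row (bipartite_game (2 ^ L) \<Gamma> s) (2 * n) (2 * u + 1)) [u..<n])"
  using assms
proof (induction k arbitrary: u m)
  case 0
  then show ?case by simp
next
  case (Suc k)
  show ?case
  proof (cases m)
    case 0
    with Suc.prems show ?thesis by simp
  next
    case m: (Suc m')
    then have u: "u < n" and upt: "[u..<n] = u # [Suc u..<n]"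
      using Suc.prems by (auto simp: upt_conv_Cons)
    have "encode_row \<Gamma> n u \<noteq> []"
      by (simp add: encode_row_def)
    then show ?thesis
      using maps_to_row[OF u Suc.prems(1), of s L] Suc.IH[of "Suc u" m'] Suc.prems m
      by (simp add: upt maps_to_def)
  qed
qed

lemma bipartite_code_encode:
  assumes "energy_instance (\<Gamma>, s)"
  shows "bipartite_code (encode (\<Gamma>, s)) =
    encode (bipartite_game (2 ^ length (encode (\<Gamma>, s))) \<Gamma> s, 2 * s)"
proof -
  define n where "n = card (pverts (arena \<Gamma>))"
  define L where "L = length (encode (\<Gamma>, s))"
  let ?rows = "concat (map (encode_row \<Gamma> n) [0..<n])"
  have enc: "encode (\<Gamma>, s) = replicate n True @ False # replicate s True @ False # ?rows"
    by (simp add: encode_def encode_unary_def n_def Let_def)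
  have parse: "length (takeWhile id (replicate m True @ False # zs)) = m"
    "tl (dropWhile id (replicate m True @ False # zs)) = zs" for m zs
    by (induction m) auto
  have "n \<le> L"
    by (simp add: L_def enc)
  have "bipartite_code (encode (\<Gamma>, s)) =
      replicate (2 * n) True @ [False] @ replicate (2 * s) True @ [False] @ rows_td n s L L 0 ?rows"
    unfolding bipartite_code_def L_def[symmetric] by (simp only: enc parse Let_def)
  also have "rows_td n s L L 0 ?rows =
      concat (map (\<lambda>u. encode_row (bipartite_game (2 ^ L) \<Gamma> s) (2 * n) (2 * u) @
        encode_row (bipartite_game (2 ^ L) \<Gamma> s) (2 * n) (2 * u + 1)) [0..<n])"
    by (rule rows_td_encode) (use n_def \<open>n \<le> L\<close> in auto)
  also have "\<dots> = concat (map (encode_row (bipartite_game (2 ^ L) \<Gamma> s) (2 * n)) [0..<2 * n])"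
    by (rule concat_map_double[symmetric])
  finally show ?thesis
    unfolding L_def[symmetric]
    by (simp add: encode_def encode_unary_def bipartite_game_def Let_def n_def)
qed

section \<open>The input length as exponent of the jump price\<close>

lemma less_power_length_encode_nat: "m < 2 ^ length (encode_nat m)"
proof (induction m rule: encode_nat.induct)
  case (1 m)
  show ?case
  proof (cases "m = 0")
    case True
    then show ?thesis by (simp add: encode_nat.simps[of m])
  next
    case False
    from 1[OF this] have "m < 2 * 2 ^ length (encode_nat (m div 2))"
      by linarith
    also have "\<dots> \<le> 2 ^ length (encode_nat m)"
      using False by (simp add: encode_nat.simps[of m])
    finally show ?thesis .
  qed
qed

text \<open>Each of the \<open>n * n\<close> entries takes at least one bit, and the entry of
  \<open>(u, v)\<close> additionally takes the code of its weight. With a weight of largest absolute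
  value this makes two to the input length a valid \<open>K\<close>.\<close>

lemma length_encode_ge:
  assumes "u < n" "v < n" "n = card (pverts (arena \<Gamma>))" "(u, v) \<in> parcs (arena \<Gamma>)"
  shows "n * n + length (encode_nat (nat \<bar>weight \<Gamma> (u, v)\<bar>)) \<le> length (encode (\<Gamma>, s))"
proof -
  let ?l = "length (encode_nat (nat \<bar>weight \<Gamma> (u, v)\<bar>))"
  let ?V = "{..<n} \<times> {..<n}"
  have "n * n + ?l = (\<Sum>e\<in>?V. 1 + (if e = (u, v) then ?l else 0))"
    using assms(1,2) by (subst sum.distrib) (simp add: sum.delta)
  also have "\<dots> \<le> (\<Sum>e\<in>?V. length (encode_entry \<Gamma> e))"
    using assms(4) by (intro sum_mono) (auto simp: encode_entry_def encode_int_def)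
  also have "\<dots> = (\<Sum>x<n. \<Sum>y<n. length (encode_entry \<Gamma> (x, y)))"
    by (simp add: sum.cartesian_product)
  also have "\<dots> \<le> (\<Sum>x<n. length (encode_row \<Gamma> n x))"
    by (intro sum_mono)
      (simp add: encode_row_def length_concat comp_def interv_sum_list_conv_sum_set_nat atLeast0LessThan)
  also have "\<dots> \<le> length (encode (\<Gamma>, s))"
    by (simp add: encode_def Let_def length_concat comp_def interv_sum_list_conv_sum_set_nat
        atLeast0LessThan flip: assms(3))
  finally show ?thesis .
qed

lemma minimal_energy_bipartite_code:
  assumes inst: "energy_instance (\<Gamma>, s)"
  shows "minimal_energy (bipartite_game (2 ^ length (encode (\<Gamma>, s))) \<Gamma> s) (2 * s) < \<infinity> \<longleftrightarrow>
    minimal_energy \<Gamma> s < \<infinity>"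
proof -
  obtain n where n: "pverts (arena \<Gamma>) = {..<n}" and wf: "weighted_game_graph \<Gamma>" and "s \<in> pverts (arena \<Gamma>)"
    using inst by (auto simp: energy_instance_def)
  then have s: "s < n" by simp
  interpret pair_fin_digraph "arena \<Gamma>"
    using wf by (simp add: weighted_game_graph_def)
  let ?w = "\<lambda>e. nat \<bar>weight \<Gamma> e\<bar>"
  have "parcs (arena \<Gamma>) \<noteq> {}"
    using wf s n by (auto simp: weighted_game_graph_def)
  then have "Max (?w ` parcs (arena \<Gamma>)) \<in> ?w ` parcs (arena \<Gamma>)"
    using pair_finite_arcs by (intro Max_in) auto
  then obtain u v where uv: "(u, v) \<in> parcs (arena \<Gamma>)" "Max (?w ` parcs (arena \<Gamma>)) = ?w (u, v)"
    by auto
  have max: "\<bar>weight \<Gamma> e\<bar> \<le> int (?w (u, v))" if "e \<in> parcs (arena \<Gamma>)" for e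
    using Max_ge[of "?w ` parcs (arena \<Gamma>)" "?w e"] pair_finite_arcs that uv(2) by auto
  have lt: "u < n" "v < n"
    using uv(1) n in_arcsD1 in_arcsD2 by auto
  let ?L = "length (encode (\<Gamma>, s))"
  \<comment> \<open>The two summands of \<open>length_encode_ge\<close> pay for the two factors of
    the bound on \<open>K\<close>: \<open>n * n\<close> bits for the number of moves, the rest for
    the weight.\<close>
  have "n * n + 1 \<le> 2 ^ (n * n)"
    using less_exp[of "n * n"] by linarith
  then have "(n * n + 1) * ?w (u, v) \<le> 2 ^ (n * n) * ?w (u, v)"
    by (rule mult_right_mono) simp
  also have "\<dots> < 2 ^ (n * n) * 2 ^ length (encode_nat (?w (u, v)))"
    using less_power_length_encode_nat by simp
  also have "\<dots> = 2 ^ (n * n + length (encode_nat (?w (u, v))))"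
    by (simp add: power_add)
  also have "\<dots> \<le> 2 ^ ?L"
    using length_encode_ge[OF lt _ uv(1), of s] n by (intro power_increasing) auto
  finally have "int ((n * n + 1) * ?w (u, v)) < int (2 ^ ?L)"
    by (simp only: of_nat_less_iff)
  then have "game_to_bipartite \<Gamma> s n (?w (u, v)) (2 ^ ?L)"
    using wf n s max by unfold_locales auto
  then show ?thesis
    by (rule game_to_bipartite.minimal_energy_bipartite_game)
qed

text \<open>Membership in an image under \<open>encode\<close> only provides some instance with the
  same code, which may have other weights on non-arcs. So both properties must depend on the code
  alone; for the energy this holds because measures consult only the weights of arcs.\<close>

lemma encode_eq_cong:
  assumes inst: "energy_instance (\<Gamma>, s)" "energy_instance (\<Gamma>', s')" and eq: "encode (\<Gamma>, s) = encode (\<Gamma>', s')"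
  shows "complete_bipartite_game \<Gamma> \<longleftrightarrow> complete_bipartite_game \<Gamma>'"
    and "minimal_energy \<Gamma> s < \<infinity> \<longleftrightarrow> minimal_energy \<Gamma>' s' < \<infinity>"
proof -
  note same = encode_injective[OF inst eq]
  show "complete_bipartite_game \<Gamma> \<longleftrightarrow> complete_bipartite_game \<Gamma>'"
    by (simp add: complete_bipartite_game_def same)
  have "covers (weight \<Gamma>) \<phi> u v \<longleftrightarrow> covers (weight \<Gamma>') \<phi> u v" if "(u, v) \<in> parcs (arena \<Gamma>')" for \<phi> u v
    using that same(5)[of "(u, v)"] by (simp add: covers_def same(1))
  then have "energy_measure \<Gamma> \<phi> \<longleftrightarrow> energy_measure \<Gamma>' \<phi>" for \<phi>
    unfolding energy_measure_def same(1-3) by meson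
  then show "minimal_energy \<Gamma> s < \<infinity> \<longleftrightarrow> minimal_energy \<Gamma>' s' < \<infinity>"
    using inst same(4) by (simp add: minimal_energy_finite_iff energy_instance_def del: enat_ord_simps)
qed

lemma yes_instances_encode:
  assumes "energy_instance (\<Gamma>, s)"
  shows "encode (\<Gamma>, s) \<in> yes_instances energy_problem \<longleftrightarrow> minimal_energy \<Gamma> s < \<infinity>"
    and "complete_bipartite_game \<Gamma> \<Longrightarrow>
      encode (\<Gamma>, s) \<in> yes_instances complete_bipartite_energy_problem \<longleftrightarrow> minimal_energy \<Gamma> s < \<infinity>"
proof -
  show "encode (\<Gamma>, s) \<in> yes_instances energy_problem \<longleftrightarrow> minimal_energy \<Gamma> s < \<infinity>"
    using assms encode_eq_cong(2)[OF assms]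
    unfolding energy_problem_def decision_problem.simps by blast
  show "encode (\<Gamma>, s) \<in> yes_instances complete_bipartite_energy_problem \<longleftrightarrow> minimal_energy \<Gamma> s < \<infinity>"
    if "complete_bipartite_game \<Gamma>"
    using assms that encode_eq_cong[OF assms]
    unfolding complete_bipartite_energy_problem_def decision_problem.simps by blast
qed

text \<open>In a machine without states the start state 0 is already a halting one.\<close>

lemma polytime_computable_id: "polytime_computable (\<lambda>x. x)"
proof -
  let ?M = "\<lparr>tape_count = 1, state_count = 0, transition = \<lambda>_ _. (0, [])\<rparr>"
  have "turing_machine ?M" "halts_with ?M x 0 x" for x
    by (simp_all add: turing_machine_def halts_with_def start_config_def)
  then show ?thesis
    unfolding polytime_computable_def by blast
qed

theorem theorem18:
  shows "polytime_equivalent complete_bipartite_energy_problem energy_problem"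
  unfolding polytime_equivalent_def
proof
  show "polytime_reducible complete_bipartite_energy_problem energy_problem"
    unfolding polytime_reducible_def
  proof (intro exI conjI ballI)
    fix x assume "x \<in> instances complete_bipartite_energy_problem"
    then obtain \<Gamma> s where "x = encode (\<Gamma>, s)" "energy_instance (\<Gamma>, s)" "complete_bipartite_game \<Gamma>"
      by (auto simp: complete_bipartite_energy_problem_def)
    note x = this
    show "x \<in> instances energy_problem"
      using x by (auto simp: energy_problem_def)
    show "x \<in> yes_instances complete_bipartite_energy_problem \<longleftrightarrow> x \<in> yes_instances energy_problem"
      unfolding x(1) yes_instances_encode(1)[OF x(2)] yes_instances_encode(2)[OF x(2,3)] ..
  qed (fact polytime_computable_id)
next
  show "polytime_reducible energy_problem complete_bipartite_energy_problem"
    unfolding polytime_reducible_def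
  proof (intro exI conjI ballI)
    fix x assume "x \<in> instances energy_problem"
    then obtain \<Gamma> s where x: "x = encode (\<Gamma>, s)" and inst: "energy_instance (\<Gamma>, s)"
      by (auto simp: energy_problem_def)
    let ?\<Delta> = "bipartite_game (2 ^ length x) \<Gamma> s"
    have code: "bipartite_code x = encode (?\<Delta>, 2 * s)"
      using bipartite_code_encode[OF inst] x by simp
    note inst' = bipartite_game_instance[OF inst, of "2 ^ length x"]
    show "bipartite_code x \<in> instances complete_bipartite_energy_problem"
      using inst' code by (auto simp: complete_bipartite_energy_problem_def)
    show "x \<in> yes_instances energy_problem \<longleftrightarrow> bipartite_code x \<in> yes_instances complete_bipartite_energy_problem"
      unfolding code yes_instances_encode(2)[OF inst']
      unfolding x yes_instances_encode(1)[OF inst] minimal_energy_bipartite_code[OF inst] ..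
  qed (fact polytime_bipartite_code)
qed

end
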